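(* Suppose $V$ is a weight $F$-module such that $z$ acts as the identity map on $V$. (1) $\lambda_k=0$ or $1$ for any $\lambda=(\lambda_0,\lambda_1,\dots)\in\mathbb{C}^\infty$ with $V_{(\lambda)}\neq0$ and any $k\in\mathbb{N}$. (2) For any $v\in V_{(\lambda)}\setminus\{0\}$, $U(F)v$ is isomorphic to $\mathscr{V}_I$ for some $I\subset\mathbb{Z}_+$, with $v$ corresponding to $\xi_I$. (3) If $V$ is further simple, then $V$ is isomorphic to $\mathscr{V}_I$ for some $I\subset\mathbb{Z}_+$.
   Context: All vector spaces and algebras are over $\mathbb{C}$; $\mathbb{Z}_+$ is the set of non-negative integers, $\mathbb{N}$ the set of positive integers. Modules over Lie superalgebras are $\mathbb{Z}_2$-graded, and simple means having no nonzero proper graded submodule. The Fermion algebra $F$ is the Lie superalgebra with basis $\{\psi_m, z: m\in\mathbb{Z}\}$, the $\psi_m$ odd and $z$ even, with $[\psi_m,\psi_n]=\delta_{m,-n}z$ and $[F,z]=0$. $U(F)$ is its universal enveloping algebra. For an $F$-module $V$ and $\lambda=(\lambda_0,\lambda_1,\dots)\in\mathbb{C}^\infty$ (the set of all complex sequences indexed by $\mathbb{Z}_+$), let $V_{(\lambda)}=\{v\in V:\psi_{-k}\psi_k\cdot v=\lambda_kv\text{ for all }k\in\mathbb{Z}_+\}$. $V$ is called a weight $F$-module if $V=\bigoplus_{\lambda\in\mathbb{C}^\infty}V_{(\lambda)}$. For $I\subset\mathbb{Z}_+$ let $S_I=\{J\subset\mathbb{Z}_+:|I\setminus J|<\infty,\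 |J\setminus I|<\infty\}$. The $F$-module $\mathscr{V}_I$ has basis $\{\xi_J:J\in S_I\}$, where $\xi_J$ has parity $|I\setminus J|+|J\setminus I|$ mod $2$, and the action for $k\in\mathbb{N}$ is: $\psi_k\cdot\xi_J=(-1)^{|\{i\in J:i<k\}|}\xi_{J\setminus\{k\}}$ if $k\in J$ and $0$ if $k\notin J$; $\psi_{-k}\cdot\xi_J=(-1)^{|\{i\in J:i<k\}|}\xi_{J\cup\{k\}}$ if $k\notin J$ and $0$ if $k\in J$; $\psi_0\cdot\xi_J=\frac1{\sqrt2}\xi_{J\setminus\{0\}}$ if $0\in J$ and $\frac1{\sqrt2}\xi_{J\cup\{0\}}$ if $0\notin J$; $z\cdot\xi_J=\xi_J$.
   Formalization: In (2), v is taken homogeneous, and the isomorphism has the parity of v (odd v gives a parity-reversing isomorphism); for inhomogeneous v such as ξ_I+√2ψ_0ξ_I the claim fails, since ψ_0v=v/√2. *)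

theory Defs
  imports Complex_Main "HOL-Library.Poly_Mapping" "HOL-Library.Z2"
begin

section \<open>Linear algebra over the complex numbers\<close>

text \<open>\<open>'a \<Rightarrow>\<^sub>0 complex\<close> is the complex vector space with basis \<open>'a\<close>; the basis
  vector of \<open>a\<close> is \<open>Poly_Mapping.single a 1\<close>.\<close>

definition pm_scale :: "complex \<Rightarrow> ('a \<Rightarrow>\<^sub>0 complex) \<Rightarrow> ('a \<Rightarrow>\<^sub>0 complex)" where
  "pm_scale c f = Poly_Mapping.map ((*) c) f"

abbreviation bvec :: "'a \<Rightarrow> ('a \<Rightarrow>\<^sub>0 complex)" where
  "bvec a \<equiv> Poly_Mapping.single a 1"

text \<open>The linear extension of \<open>g\<close> from the basis \<open>'a\<close> to all of \<open>'a \<Rightarrow>\<^sub>0 complex\<close>.\<close>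

definition lin_ext :: "(complex \<Rightarrow> 'b \<Rightarrow> 'b) \<Rightarrow> ('a \<Rightarrow> 'b) \<Rightarrow> ('a \<Rightarrow>\<^sub>0 complex) \<Rightarrow> 'b::ab_group_add" where
  "lin_ext s g f = (\<Sum>a\<in>Poly_Mapping.keys f. s (Poly_Mapping.lookup f a) (g a))"

text \<open>Internal direct sum \<open>V = \<Oplus>\<^sub>i W i\<close> of subspaces: every vector is the sum of a unique
  finitely supported family of components.\<close>

definition is_direct_sum :: "(complex \<Rightarrow> 'v \<Rightarrow> 'v) \<Rightarrow> 'v set \<Rightarrow> ('i \<Rightarrow> 'v::ab_group_add set) \<Rightarrow> bool" where
  "is_direct_sum s V W \<longleftrightarrow>
     module.subspace s V \<and> (\<forall>i. module.subspace s (W i) \<and> W i \<subseteq> V) \<and>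
     (\<forall>v\<in>V. \<exists>!f :: 'i \<Rightarrow>\<^sub>0 'v. (\<forall>i. Poly_Mapping.lookup f i \<in> W i) \<and>
        v = (\<Sum>i\<in>Poly_Mapping.keys f. Poly_Mapping.lookup f i))"

text \<open>A \<open>\<int>\<^sub>2\<close>-graded space is a direct sum of an even and an odd part, the parities being the
  elements of the two-element field \<open>bit\<close>.\<close>

definition koszul :: "bit \<Rightarrow> bit \<Rightarrow> complex" where
  "koszul p q = (if p = 1 \<and> q = 1 then - 1 else 1)"

lemma lookup_pm_scale [simp]:
  "Poly_Mapping.lookup (pm_scale c f) a = c * Poly_Mapping.lookup f a"
  unfolding pm_scale_def by transfer (simp add: when_def)

lemma vector_space_pm_scale: "vector_space pm_scale"
  by unfold_locales (auto intro!: poly_mapping_eqI simp: lookup_add algebra_simps)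

lemma lin_ext_superset:
  assumes "vector_space s" "finite A" "Poly_Mapping.keys f \<subseteq> A"
  shows "lin_ext s g f = (\<Sum>a\<in>A. s (Poly_Mapping.lookup f a) (g a))"
proof -
  interpret vector_space s by fact
  show ?thesis unfolding lin_ext_def
    using assms by (intro sum.mono_neutral_left) (auto simp: in_keys_iff)
qed

lemma lin_ext_add:
  assumes "vector_space s"
  shows "lin_ext s g (f + h) = lin_ext s g f + lin_ext s g h"
proof -
  interpret vector_space s by fact
  let ?A = "Poly_Mapping.keys f \<union> Poly_Mapping.keys h"
  have "lin_ext s g k = (\<Sum>a\<in>?A. s (Poly_Mapping.lookup k a) (g a))" if "k \<in> {f + h, f, h}" for k
    by (rule lin_ext_superset) (use assms that Poly_Mapping.keys_add[of f h] in auto)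
  then show ?thesis by (simp add: lookup_add scale_left_distrib sum.distrib)
qed

lemma lin_ext_scale:
  assumes "vector_space s"
  shows "lin_ext s g (pm_scale c f) = s c (lin_ext s g f)"
proof -
  interpret vector_space s by fact
  have "lin_ext s g k = (\<Sum>a\<in>Poly_Mapping.keys f. s (Poly_Mapping.lookup k a) (g a))"
    if "k \<in> {pm_scale c f, f}" for k
    by (rule lin_ext_superset) (use assms that in \<open>auto simp: in_keys_iff\<close>)
  then show ?thesis by (simp add: scale_sum_right)
qed

lemma lin_ext_single:
  assumes "vector_space s"
  shows "lin_ext s g (Poly_Mapping.single a c) = s c (g a)"
proof -
  interpret vector_space s by fact
  show ?thesis by (simp add: lin_ext_def)
qed

lemma lin_ext_diff:
  assumes "vector_space s"
  shows "lin_ext s g (f - h) = lin_ext s g f - lin_ext s g h"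
  using lin_ext_add[OF assms, of g "f - h" h] by simp

lemma is_direct_sum_bitI:
  fixes P :: "bit \<Rightarrow> 'v::ab_group_add set"
  assumes s: "vector_space s" and P: "\<And>p. module.subspace s (P p)"
    and disj: "\<And>v. v \<in> P 0 \<Longrightarrow> v \<in> P 1 \<Longrightarrow> v = 0"
    and V: "V = {v + w | v w. v \<in> P 0 \<and> w \<in> P 1}"
  shows "is_direct_sum s V P"
proof -
  interpret vector_space s by fact
  have univ: "(UNIV :: bit set) = {0, 1}" by auto
  have allb: "(\<forall>i. Q i) \<longleftrightarrow> Q 0 \<and> Q 1" for Q :: "bit \<Rightarrow> bool" by (metis bit.exhaust)
  have ksum: "(\<Sum>i\<in>Poly_Mapping.keys f. Poly_Mapping.lookup f i) = Poly_Mapping.lookup f 0 + Poly_Mapping.lookup f 1"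
    for f :: "bit \<Rightarrow>\<^sub>0 'v"
  proof -
    have "Poly_Mapping.keys f \<subseteq> {0, 1}" unfolding univ[symmetric] by (rule subset_UNIV)
    then have "(\<Sum>i\<in>Poly_Mapping.keys f. Poly_Mapping.lookup f i) = (\<Sum>i\<in>{0, 1}. Poly_Mapping.lookup f i)"
      by (intro sum.mono_neutral_left ballI) (simp_all add: in_keys_iff del: insert_iff)
    then show ?thesis by simp
  qed
  have zero: "0 \<in> P p" for p using subspace_0[OF P] .
  have sub: "P p \<subseteq> V" for p
  proof
    fix v assume v: "v \<in> P p"
    show "v \<in> V"
    proof (cases p)
      assume "p = 0"
      then have "v = v + 0 \<and> v \<in> P 0 \<and> 0 \<in> P 1" using v zero by simp
      then show ?thesis unfolding V by blast
    next
      assume "p = 1"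
      then have "v = 0 + v \<and> 0 \<in> P 0 \<and> v \<in> P 1" using v zero by simp
      then show ?thesis unfolding V by blast
    qed
  qed
  have "\<exists>!f :: bit \<Rightarrow>\<^sub>0 'v. (\<forall>i. Poly_Mapping.lookup f i \<in> P i) \<and>
        v = (\<Sum>i\<in>Poly_Mapping.keys f. Poly_Mapping.lookup f i)" if "v \<in> V" for v
  proof -
    from that obtain a b where ab: "a \<in> P 0" "b \<in> P 1" "v = a + b" using V by blast
    show ?thesis unfolding ksum allb
    proof (rule ex1I)
      let ?f = "Poly_Mapping.single 0 a + Poly_Mapping.single (1::bit) b"
      show "(Poly_Mapping.lookup ?f 0 \<in> P 0 \<and> Poly_Mapping.lookup ?f 1 \<in> P 1) \<and>
          v = Poly_Mapping.lookup ?f 0 + Poly_Mapping.lookup ?f 1"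
        using ab by (simp add: lookup_add lookup_single)
      fix f :: "bit \<Rightarrow>\<^sub>0 'v"
      assume f: "(Poly_Mapping.lookup f 0 \<in> P 0 \<and> Poly_Mapping.lookup f 1 \<in> P 1) \<and>
          v = Poly_Mapping.lookup f 0 + Poly_Mapping.lookup f 1"
      have eq: "Poly_Mapping.lookup f 0 - a = b - Poly_Mapping.lookup f 1"
        using f ab by (simp add: algebra_simps)
      have "Poly_Mapping.lookup f 0 - a \<in> P 0" using f ab subspace_diff[OF P] by blast
      moreover have "Poly_Mapping.lookup f 0 - a \<in> P 1"
        unfolding eq using f ab subspace_diff[OF P] by blast
      ultimately have "Poly_Mapping.lookup f 0 = a" using disj[of "Poly_Mapping.lookup f 0 - a"] by simp
      moreover from this have "Poly_Mapping.lookup f 1 = b" using eq by simp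
      ultimately have fab: "Poly_Mapping.lookup f 0 = a \<and> Poly_Mapping.lookup f 1 = b" by blast
      show "f = ?f"
      proof (intro poly_mapping_eqI)
        fix i :: bit
        show "Poly_Mapping.lookup f i = Poly_Mapping.lookup ?f i"
          by (cases i) (simp_all add: fab lookup_add lookup_single)
      qed
    qed
  qed
  moreover have "subspace V" unfolding V using subspace_sums[OF P P] .
  ultimately show ?thesis using P sub by (simp add: is_direct_sum_def)
qed

lemma is_direct_sum_parity:
  fixes q :: "'a \<Rightarrow> bit"
  shows "is_direct_sum pm_scale {f. Poly_Mapping.keys f \<subseteq> S}
    (\<lambda>p. {f. Poly_Mapping.keys f \<subseteq> {a \<in> S. q a = p}})"
proof (rule is_direct_sum_bitI[OF vector_space_pm_scale])
  interpret vector_space "pm_scale :: complex \<Rightarrow> ('a \<Rightarrow>\<^sub>0 complex) \<Rightarrow> _"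
    by (rule vector_space_pm_scale)
  have keys: "Poly_Mapping.keys f \<subseteq> A \<longleftrightarrow> (\<forall>a. a \<notin> A \<longrightarrow> Poly_Mapping.lookup f a = 0)"
    for f :: "'a \<Rightarrow>\<^sub>0 complex" and A by (auto simp: in_keys_iff)
  show "subspace {f. Poly_Mapping.keys f \<subseteq> {a \<in> S. q a = p}}" for p
    unfolding keys by (rule subspaceI) (simp_all add: lookup_add)
  show "v = 0" if "v \<in> {f. Poly_Mapping.keys f \<subseteq> {a \<in> S. q a = 0}}"
    "v \<in> {f. Poly_Mapping.keys f \<subseteq> {a \<in> S. q a = 1}}" for v :: "'a \<Rightarrow>\<^sub>0 complex"
    using that by (intro poly_mapping_eqI) (fastforce simp: keys)
  show "{f. Poly_Mapping.keys f \<subseteq> S} = {v + w | v w. v \<in> {f. Poly_Mapping.keys f \<subseteq> {a \<in> S. q a = 0}} \<and>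
      w \<in> {f :: 'a \<Rightarrow>\<^sub>0 complex. Poly_Mapping.keys f \<subseteq> {a \<in> S. q a = 1}}}" (is "?L = ?R")
  proof
    show "?R \<subseteq> ?L" unfolding keys by (auto simp: lookup_add)
    show "?L \<subseteq> ?R"
    proof
      fix f :: "'a \<Rightarrow>\<^sub>0 complex" assume f: "f \<in> ?L"
      define g where "g p = Poly_Mapping.mapp (\<lambda>a c. if q a = p then c else 0) f" for p
      have lk: "Poly_Mapping.lookup (g p) a = (if q a = p then Poly_Mapping.lookup f a else 0)" for p a
        by (simp add: g_def lookup_mapp when_def in_keys_iff)
      have "f = g 0 + g 1"
        by (rule poly_mapping_eqI) (simp add: lookup_add lk)
      moreover have "g p \<in> {f. Poly_Mapping.keys f \<subseteq> {a \<in> S. q a = p}}" for p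
        using f by (auto simp: keys lk)
      ultimately show "f \<in> ?R" by blast
    qed
  qed
qed


section \<open>Lie superalgebras, their modules and enveloping algebras\<close>

record ('g, 'v) smod =
  carr :: "'v set"
  smul :: "complex \<Rightarrow> 'v \<Rightarrow> 'v"
  part :: "bit \<Rightarrow> 'v set"
  act  :: "'g \<Rightarrow> 'v \<Rightarrow> 'v"

text \<open>The subset \<open>W\<close> with the induced structure; \<open>W\<close> is a graded submodule iff this is again
  a module.\<close>

definition sub_smod :: "('g, 'v) smod \<Rightarrow> 'v set \<Rightarrow> ('g, 'v) smod" where
  "sub_smod M W = M\<lparr>carr := W, part := (\<lambda>p. part M p \<inter> W)\<rparr>"

locale lie_superalgebra = vector_space scale
  for scale :: "complex \<Rightarrow> 'g::ab_group_add \<Rightarrow> 'g" +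
  fixes gr :: "bit \<Rightarrow> 'g set" and br :: "'g \<Rightarrow> 'g \<Rightarrow> 'g"
  assumes grading: "is_direct_sum scale UNIV gr"
    and br_add_left: "br (x + y) w = br x w + br y w"
    and br_add_right: "br w (x + y) = br w x + br w y"
    and br_scale_left: "br (scale c x) y = scale c (br x y)"
    and br_scale_right: "br x (scale c y) = scale c (br x y)"
    and br_grade: "x \<in> gr p \<Longrightarrow> y \<in> gr q \<Longrightarrow> br x y \<in> gr (p + q)"
    and br_skew: "x \<in> gr p \<Longrightarrow> y \<in> gr q \<Longrightarrow> br x y = scale (- koszul p q) (br y x)"
    and br_jacobi: "x \<in> gr p \<Longrightarrow> y \<in> gr q \<Longrightarrow> w \<in> gr r \<Longrightarrow>
      br x (br y w) = br (br x y) w + scale (koszul p q) (br y (br x w))"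
begin

definition smodule :: "('g, 'v::ab_group_add) smod \<Rightarrow> bool" where
  "smodule M \<longleftrightarrow>
     vector_space (smul M) \<and> is_direct_sum (smul M) (carr M) (part M) \<and>
     (\<forall>x p v q. x \<in> gr p \<longrightarrow> v \<in> part M q \<longrightarrow> act M x v \<in> part M (p + q)) \<and>
     (\<forall>x. \<forall>v\<in>carr M. act M x v \<in> carr M) \<and>
     (\<forall>x y. \<forall>v\<in>carr M. act M (x + y) v = act M x v + act M y v) \<and>
     (\<forall>c x. \<forall>v\<in>carr M. act M (scale c x) v = smul M c (act M x v)) \<and>
     (\<forall>x. \<forall>v\<in>carr M. \<forall>w\<in>carr M. act M x (v + w) = act M x v + act M x w) \<and>
     (\<forall>x c. \<forall>v\<in>carr M. act M x (smul M c v) = smul M c (act M x v)) \<and>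
     (\<forall>x y p q. x \<in> gr p \<longrightarrow> y \<in> gr q \<longrightarrow> (\<forall>v\<in>carr M.
        act M (br x y) v = act M x (act M y v) - smul M (koszul p q) (act M y (act M x v))))"

definition graded_submodule :: "('g, 'v::ab_group_add) smod \<Rightarrow> 'v set \<Rightarrow> bool" where
  "graded_submodule M W \<longleftrightarrow> W \<subseteq> carr M \<and> smodule (sub_smod M W)"

definition simple_smodule :: "('g, 'v::ab_group_add) smod \<Rightarrow> bool" where
  "simple_smodule M \<longleftrightarrow> smodule M \<and> carr M \<noteq> {0} \<and>
     (\<forall>W. graded_submodule M W \<longrightarrow> W = {0} \<or> W = carr M)"

text \<open>Isomorphisms that are homogeneous of parity \<open>d\<close> and commute with the action (without
  sign). Those of parity \<open>0\<close> are the even isomorphisms; those of parity \<open>1\<close> are the even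
  isomorphisms onto \<open>N\<close> with its two parts interchanged.\<close>

definition smod_iso ::
  "bit \<Rightarrow> ('g, 'v::ab_group_add) smod \<Rightarrow> ('g, 'w::ab_group_add) smod \<Rightarrow> ('v \<Rightarrow> 'w) \<Rightarrow> bool" where
  "smod_iso d M N \<phi> \<longleftrightarrow> smodule M \<and> smodule N \<and> bij_betw \<phi> (carr M) (carr N) \<and>
     (\<forall>v\<in>carr M. \<forall>w\<in>carr M. \<phi> (v + w) = \<phi> v + \<phi> w) \<and>
     (\<forall>c. \<forall>v\<in>carr M. \<phi> (smul M c v) = smul N c (\<phi> v)) \<and>
     (\<forall>x. \<forall>v\<in>carr M. \<phi> (act M x v) = act N x (\<phi> v)) \<and>
     (\<forall>p. \<phi> ` part M p = part N (p + d))"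

definition smod_isomorphic ::
  "('g, 'v::ab_group_add) smod \<Rightarrow> ('g, 'w::ab_group_add) smod \<Rightarrow> bool" where
  "smod_isomorphic M N \<longleftrightarrow> (\<exists>\<phi>. smod_iso 0 M N \<phi>)"

text \<open>The universal enveloping algebra is presented as a quotient of the free associative algebra
  \<open>'g list \<Rightarrow>\<^sub>0 complex\<close> on the \<^emph>\<open>set\<close> of all elements of the Lie superalgebra (words multiply by
  concatenation, the empty word is the unit). The first two families of relations make the inclusion of generators linear, so
  the quotient by them is the tensor algebra; the third one is the usual relation
  \<open>x \<otimes> y - (-1)\<^bsup>|x||y|\<^esup> y \<otimes> x - [x, y]\<close>.\<close>

definition U_rel :: "('g list \<Rightarrow>\<^sub>0 complex) set" where
  "U_rel =
     {bvec [x + y] - bvec [x] - bvec [y] | x y. True} \<union>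
     {bvec [scale c x] - pm_scale c (bvec [x]) | c x. True} \<union>
     {bvec [x, y] - pm_scale (koszul p q) (bvec [y, x]) - bvec [br x y] | x y p q.
        x \<in> gr p \<and> y \<in> gr q}"

definition U_ideal :: "('g list \<Rightarrow>\<^sub>0 complex) set" where
  "U_ideal = module.span pm_scale
     {lin_ext pm_scale (\<lambda>b. bvec (a @ b @ c)) r | a r c. r \<in> U_rel}"

definition U_cong :: "(('g list \<Rightarrow>\<^sub>0 complex) \<times> ('g list \<Rightarrow>\<^sub>0 complex)) set" where
  "U_cong = {(s, t). s - t \<in> U_ideal}"

definition U_alg :: "('g list \<Rightarrow>\<^sub>0 complex) set set" where
  "U_alg = UNIV // U_cong"

definition free_act :: "('g, 'v::ab_group_add) smod \<Rightarrow> ('g list \<Rightarrow>\<^sub>0 complex) \<Rightarrow> 'v \<Rightarrow> 'v" where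
  "free_act M t v = lin_ext (smul M) (\<lambda>xs. foldr (act M) xs v) t"

text \<open>A class \<open>u\<close> acts by the common action of all its representatives, see
  \<open>U_act_class\<close> below.\<close>

definition U_act :: "('g, 'v::ab_group_add) smod \<Rightarrow> ('g list \<Rightarrow>\<^sub>0 complex) set \<Rightarrow> 'v \<Rightarrow> 'v" where
  "U_act M u v = the_elem ((\<lambda>t. free_act M t v) ` u)"

definition U_orbit :: "('g, 'v::ab_group_add) smod \<Rightarrow> 'v \<Rightarrow> 'v set" where
  "U_orbit M v = {U_act M u v | u. u \<in> U_alg}"

lemma equiv_U_cong: "equiv UNIV U_cong"
proof -
  interpret P: vector_space "pm_scale :: complex \<Rightarrow> ('g list \<Rightarrow>\<^sub>0 complex) \<Rightarrow> _"
    by (rule vector_space_pm_scale)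
  have sub: "P.subspace U_ideal" unfolding U_ideal_def by (rule P.subspace_span)
  show ?thesis unfolding equiv_def
  proof (intro conjI)
    show "refl U_cong" using P.subspace_0[OF sub] by (auto simp: refl_on_def U_cong_def)
    show "sym U_cong"
    proof (rule symI)
      fix s t :: "'g list \<Rightarrow>\<^sub>0 complex"
      assume "(s, t) \<in> U_cong"
      then show "(t, s) \<in> U_cong" using P.subspace_neg[OF sub, of "s - t"] by (simp add: U_cong_def)
    qed
    show "trans U_cong"
    proof (rule transI)
      fix s t r :: "'g list \<Rightarrow>\<^sub>0 complex"
      assume "(s, t) \<in> U_cong" "(t, r) \<in> U_cong"
      then show "(s, r) \<in> U_cong"
        using P.subspace_add[OF sub, of "s - t" "t - r"] by (simp add: U_cong_def)
    qed
  qed simp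
qed

lemma foldr_act_carr:
  assumes "smodule M" "v \<in> carr M"
  shows "foldr (act M) xs v \<in> carr M"
  using assms by (induction xs) (auto simp: smodule_def)

lemma U_rel_acts_zero:
  assumes M: "smodule M" and v: "v \<in> carr M" and r: "r \<in> U_rel"
  shows "free_act M (lin_ext pm_scale (\<lambda>b. bvec (a @ b @ c)) r) v = 0"
proof -
  have vs: "vector_space (smul M)" using M by (simp add: smodule_def)
  interpret S: vector_space "smul M" by fact
  note [simp] = lin_ext_diff[OF vs] lin_ext_scale[OF vs] lin_ext_single[OF vs]
    lin_ext_diff[OF vector_space_pm_scale] lin_ext_scale[OF vector_space_pm_scale]
    lin_ext_single[OF vector_space_pm_scale]
  define w where "w = foldr (act M) c v"
  have w: "w \<in> carr M" unfolding w_def by (rule foldr_act_carr[OF M v])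
  have sub: "S.subspace (carr M)" using M by (simp add: smodule_def is_direct_sum_def)
  note C = foldr_act_carr[OF M] S.subspace_add[OF sub] S.subspace_diff[OF sub] S.subspace_scale[OF sub]
  have A: "act M x u \<in> carr M" if "u \<in> carr M" for x u
    using M that by (simp add: smodule_def)
  have L: "act M x (u + u') = act M x u + act M x u'" if "u \<in> carr M" "u' \<in> carr M" for x u u'
    using M that by (simp add: smodule_def)
  have L': "act M x (smul M k u) = smul M k (act M x u)" if "u \<in> carr M" for x u k
    using M that by (simp add: smodule_def)
  have F0: "foldr (act M) a (u + u') = foldr (act M) a u + foldr (act M) a u'"
    if "u \<in> carr M" "u' \<in> carr M" for u u'
    using that by (induction a) (simp_all add: L L' C(1))
  have F1: "foldr (act M) a (smul M k u) = smul M k (foldr (act M) a u)"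
    if "u \<in> carr M" for u k
    using that by (induction a) (simp_all add: L L' C(1))
  have F2: "foldr (act M) a (u - u') = foldr (act M) a u - foldr (act M) a u'"
    if "u \<in> carr M" "u' \<in> carr M" for u u'
    using F0[OF C(3)[OF that] that(2)] by simp
  from r consider
      (add) x y where "r = bvec [x + y] - bvec [x] - bvec [y]"
    | (scl) k x where "r = bvec [scale k x] - pm_scale k (bvec [x])"
    | (br) x y p q where "r = bvec [x, y] - pm_scale (koszul p q) (bvec [y, x]) - bvec [br x y]"
        "x \<in> gr p" "y \<in> gr q"
    unfolding U_rel_def by blast
  then show ?thesis
  proof cases
    case add
    have "act M (x + y) w = act M x w + act M y w" using M w by (simp add: smodule_def)
    then show ?thesis using add A w by (simp add: free_act_def F0 flip: w_def)
  next
    case scl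
    have "act M (scale k x) w = smul M k (act M x w)" using M w by (simp add: smodule_def)
    then show ?thesis using scl A w by (simp add: free_act_def F1 flip: w_def)
  next
    case br
    have "act M (br x y) w = act M x (act M y w) - smul M (koszul p q) (act M y (act M x w))"
      using M w br by (simp add: smodule_def)
    then show ?thesis using br A w C by (simp add: free_act_def F1 F2 flip: w_def)
  qed
qed

lemma U_ideal_acts_zero:
  assumes M: "smodule M" and v: "v \<in> carr M" and t: "t \<in> U_ideal"
  shows "free_act M t v = 0"
proof -
  have vs: "vector_space (smul M)" using M by (simp add: smodule_def)
  interpret S: vector_space "smul M" by fact
  interpret P: vector_space "pm_scale :: complex \<Rightarrow> ('g list \<Rightarrow>\<^sub>0 complex) \<Rightarrow> _"
    by (rule vector_space_pm_scale)
  have "P.subspace {t. free_act M t v = 0}"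
    by (rule P.subspaceI)
      (simp_all add: free_act_def lin_ext_add[OF vs] lin_ext_scale[OF vs] lin_ext_def[of _ _ 0])
  moreover have "{lin_ext pm_scale (\<lambda>b. bvec (a @ b @ c)) r | a r c. r \<in> U_rel}
      \<subseteq> {t. free_act M t v = 0}"
    using U_rel_acts_zero[OF M v] by blast
  ultimately have "U_ideal \<subseteq> {t. free_act M t v = 0}"
    unfolding U_ideal_def by (rule P.span_minimal[rotated])
  then show ?thesis using t by blast
qed

lemma U_act_class:
  assumes M: "smodule M" and v: "v \<in> carr M"
  shows "U_act M (U_cong `` {t}) v = free_act M t v"
proof -
  have vs: "vector_space (smul M)" using M by (simp add: smodule_def)
  have "free_act M s v = free_act M t v" if "s \<in> U_cong `` {t}" for s
    using U_ideal_acts_zero[OF M v, of "t - s"] that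
    by (simp add: U_cong_def free_act_def lin_ext_diff[OF vs])
  moreover have "t \<in> U_cong `` {t}" by (rule equiv_class_self[OF equiv_U_cong]) simp
  ultimately have "(\<lambda>s. free_act M s v) ` (U_cong `` {t}) = {free_act M t v}" by blast
  then show ?thesis by (simp add: U_act_def)
qed

lemma U_orbit_eq:
  assumes "smodule M" "v \<in> carr M"
  shows "U_orbit M v = range (\<lambda>t. free_act M t v)"
proof -
  have "U_orbit M v = range (\<lambda>t. U_act M (U_cong `` {t}) v)"
    unfolding U_orbit_def U_alg_def quotient_def by blast
  then show ?thesis by (simp only: U_act_class[OF assms])
qed

end


section \<open>The Fermion algebra\<close>

datatype fgen = Psi int | Zc

type_synonym fermion = "fgen \<Rightarrow>\<^sub>0 complex"

abbreviation psi :: "int \<Rightarrow> fermion" where "psi m \<equiv> bvec (Psi m)"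
abbreviation zel :: fermion where "zel \<equiv> bvec Zc"

fun fgen_parity :: "fgen \<Rightarrow> bit" where
  "fgen_parity (Psi m) = 1"
| "fgen_parity Zc = 0"

definition fermion_gr :: "bit \<Rightarrow> fermion set" where
  "fermion_gr p = {x. \<forall>a\<in>Poly_Mapping.keys x. fgen_parity a = p}"

fun fgen_br :: "fgen \<Rightarrow> fgen \<Rightarrow> fermion" where
  "fgen_br (Psi m) (Psi n) = (if m = - n then zel else 0)"
| "fgen_br (Psi m) Zc = 0"
| "fgen_br Zc b = 0"

definition fermion_br :: "fermion \<Rightarrow> fermion \<Rightarrow> fermion" where
  "fermion_br x y = lin_ext pm_scale (\<lambda>a. lin_ext pm_scale (fgen_br a) y) x"

lemma fermion_br_add_left: "fermion_br (x + y) w = fermion_br x w + fermion_br y w"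
  by (simp add: fermion_br_def lin_ext_add[OF vector_space_pm_scale])

lemma lin_ext_fun_add:
  assumes "vector_space s"
  shows "lin_ext s (\<lambda>a. g a + h a) x = lin_ext s g x + lin_ext s h x"
proof -
  interpret vector_space s by fact
  show ?thesis by (simp add: lin_ext_def scale_right_distrib sum.distrib)
qed

lemma lin_ext_fun_scale:
  assumes "vector_space s"
  shows "lin_ext s (\<lambda>a. s c (g a)) x = s c (lin_ext s g x)"
proof -
  interpret vector_space s by fact
  show ?thesis by (simp add: lin_ext_def scale_sum_right mult.commute)
qed

lemma fermion_br_scale_left: "fermion_br (pm_scale c x) w = pm_scale c (fermion_br x w)"
  by (simp add: fermion_br_def lin_ext_scale[OF vector_space_pm_scale])

lemma fermion_br_add_right: "fermion_br w (x + y) = fermion_br w x + fermion_br w y"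
  by (simp add: fermion_br_def lin_ext_add[OF vector_space_pm_scale]
      lin_ext_fun_add[OF vector_space_pm_scale])

lemma fermion_br_scale_right: "fermion_br w (pm_scale c x) = pm_scale c (fermion_br w x)"
  by (simp add: fermion_br_def lin_ext_scale[OF vector_space_pm_scale]
      lin_ext_fun_scale[OF vector_space_pm_scale])

lemma fermion_br_basis: "fermion_br (bvec a) (bvec b) = fgen_br a b"
proof -
  interpret vector_space "pm_scale :: complex \<Rightarrow> fermion \<Rightarrow> _" by (rule vector_space_pm_scale)
  show ?thesis by (simp add: fermion_br_def lin_ext_single[OF vector_space_pm_scale])
qed

text \<open>Homogeneous elements are spanned by homogeneous basis vectors.\<close>

lemma pm_induct [consumes 1, case_names zero add scale basis]:
  fixes x :: "'a \<Rightarrow>\<^sub>0 complex"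
  assumes "Poly_Mapping.keys x \<subseteq> A" and "P 0" and "\<And>x y. P x \<Longrightarrow> P y \<Longrightarrow> P (x + y)"
    and "\<And>c x. P x \<Longrightarrow> P (pm_scale c x)" and "\<And>a. a \<in> A \<Longrightarrow> P (bvec a)"
  shows "P x"
proof -
  have single: "Poly_Mapping.single a c = pm_scale c (bvec a)" for a :: 'a and c
    by (rule poly_mapping_eqI) (simp add: lookup_single when_def)
  have x: "x = (\<Sum>a\<in>Poly_Mapping.keys x. pm_scale (Poly_Mapping.lookup x a) (bvec a))"
    by (rule poly_mapping_eqI) (simp add: lookup_sum lookup_single when_def in_keys_iff if_distrib[of "\<lambda>y. _ * y"] cong: if_cong)
  have "P (\<Sum>a\<in>B. pm_scale (Poly_Mapping.lookup x a) (bvec a))" if "finite B" "B \<subseteq> A" for B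
    using that by (induction B) (auto intro: assms(2-5))
  from this[OF _ assms(1)] show ?thesis using x by simp
qed

lemma fermion_br_zero [simp]: "fermion_br 0 x = 0" "fermion_br x 0 = 0"
  using fermion_br_add_left[of 0 0 x] fermion_br_add_right[of x 0 0] by simp_all

lemma fermion_gr_alt: "fermion_gr p = {x. Poly_Mapping.keys x \<subseteq> {a \<in> UNIV. fgen_parity a = p}}"
  by (auto simp: fermion_gr_def)

lemma fermion_gr_subspace: "module.subspace pm_scale (fermion_gr p)"
  using is_direct_sum_parity[of UNIV fgen_parity] by (simp add: is_direct_sum_def fermion_gr_alt)

lemma fgen_br_mult: "\<exists>c. fgen_br a b = pm_scale c zel"
proof -
  have "zel = pm_scale 1 zel" "0 = pm_scale 0 zel" by (auto intro!: poly_mapping_eqI)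
  then show ?thesis by (cases "(a, b)" rule: fgen_br.cases) (simp_all, metis+)
qed

lemma fermion_br_mult: "\<exists>c. fermion_br x y = pm_scale c zel"
proof -
  interpret vector_space "pm_scale :: complex \<Rightarrow> fermion \<Rightarrow> _" by (rule vector_space_pm_scale)
  have "Poly_Mapping.keys x \<subseteq> UNIV" "Poly_Mapping.keys y \<subseteq> UNIV" by auto
  then show ?thesis
  proof (induction x rule: pm_induct)
    case (basis a)
    from basis(2) show ?case
    proof (induction y rule: pm_induct)
      case (basis b) show ?case by (simp add: fermion_br_basis fgen_br_mult)
    qed (auto simp: fermion_br_add_right fermion_br_scale_right simp flip: scale_left_distrib
        intro: exI[of _ 0])
  qed (auto simp: fermion_br_add_left fermion_br_scale_left simp flip: scale_left_distrib
        intro: exI[of _ 0])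
qed

lemma fermion_br_zel: "fermion_br zel x = 0" "fermion_br x zel = 0"
proof -
  interpret vector_space "pm_scale :: complex \<Rightarrow> fermion \<Rightarrow> _" by (rule vector_space_pm_scale)
  have k: "Poly_Mapping.keys x \<subseteq> UNIV" by auto
  from k show "fermion_br zel x = 0"
    by (induction x rule: pm_induct)
      (simp_all add: fermion_br_add_right fermion_br_scale_right fermion_br_basis)
  have z: "fgen_br a Zc = 0" for a by (cases a) simp_all
  from k show "fermion_br x zel = 0"
    by (induction x rule: pm_induct)
      (simp_all add: fermion_br_add_left fermion_br_scale_left fermion_br_basis z)
qed

lemma fermion_br_br: "fermion_br w (fermion_br x y) = 0" "fermion_br (fermion_br x y) w = 0"
proof -
  interpret vector_space "pm_scale :: complex \<Rightarrow> fermion \<Rightarrow> _" by (rule vector_space_pm_scale)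
  obtain c where "fermion_br x y = pm_scale c zel" using fermion_br_mult by blast
  then show "fermion_br w (fermion_br x y) = 0" "fermion_br (fermion_br x y) w = 0"
    by (simp_all add: fermion_br_scale_left fermion_br_scale_right fermion_br_zel)
qed

lemma fgen_br_gr: "fgen_br a b \<in> fermion_gr (fgen_parity a + fgen_parity b)"
  by (cases "(a, b)" rule: fgen_br.cases) (simp_all add: fermion_gr_def)

lemma fgen_br_skew:
  "fgen_br a b = pm_scale (- koszul (fgen_parity a) (fgen_parity b)) (fgen_br b a)"
proof -
  have "pm_scale c 0 = 0" "pm_scale 1 f = f" for c and f :: fermion
    by (auto intro!: poly_mapping_eqI)
  moreover have "fgen_br b Zc = 0" by (cases b) simp_all
  ultimately show ?thesis
    by (cases "(a, b)" rule: fgen_br.cases) (auto simp: koszul_def)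
qed

global_interpretation fermion: lie_superalgebra pm_scale fermion_gr fermion_br
proof -
  interpret P: vector_space "pm_scale :: complex \<Rightarrow> fermion \<Rightarrow> _" by (rule vector_space_pm_scale)
  show "lie_superalgebra pm_scale fermion_gr fermion_br"
  proof
    show "is_direct_sum pm_scale UNIV fermion_gr"
      using is_direct_sum_parity[of UNIV fgen_parity]
      unfolding fermion_gr_alt[symmetric] by simp
  next
    fix x y p q assume "x \<in> fermion_gr p" "y \<in> fermion_gr q"
    then have k: "Poly_Mapping.keys x \<subseteq> {a. fgen_parity a = p}"
      "Poly_Mapping.keys y \<subseteq> {a. fgen_parity a = q}" by (auto simp: fermion_gr_def)
    note sub = P.subspace_0[OF fermion_gr_subspace] P.subspace_add[OF fermion_gr_subspace]
      P.subspace_scale[OF fermion_gr_subspace]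
    show "fermion_br x y \<in> fermion_gr (p + q)"
      using k
    proof (induction x rule: pm_induct)
      case (basis a)
      from basis(2) show ?case
      proof (induction y rule: pm_induct)
        case (basis b)
        then show ?case using \<open>a \<in> _\<close> fgen_br_gr[of a b] by (simp add: fermion_br_basis)
      qed (simp_all add: fermion_br_add_right fermion_br_scale_right sub)
    qed (simp_all add: fermion_br_add_left fermion_br_scale_left sub)
    show "fermion_br x y = pm_scale (- koszul p q) (fermion_br y x)"
      using k
    proof (induction x rule: pm_induct)
      case (basis a)
      from basis(2) show ?case
      proof (induction y rule: pm_induct)
        case (basis b)
        then show ?case using \<open>a \<in> _\<close> fgen_br_skew[of a b] by (simp add: fermion_br_basis)
      qed (simp_all add: fermion_br_add_left fermion_br_scale_left fermion_br_add_right
          fermion_br_scale_right P.scale_right_distrib mult.commute)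
    qed (simp_all add: fermion_br_add_left fermion_br_scale_left fermion_br_add_right
          fermion_br_scale_right P.scale_right_distrib mult.commute)
  qed (simp_all add: fermion_br_add_left fermion_br_scale_left fermion_br_add_right
          fermion_br_scale_right fermion_br_br)
qed


section \<open>Weight modules and the modules on the classes \<open>S\<^sub>I\<close>\<close>

definition weight_space :: "(fermion, 'v::ab_group_add) smod \<Rightarrow> (nat \<Rightarrow> complex) \<Rightarrow> 'v set" where
  "weight_space M l = {v \<in> carr M. \<forall>k.
     act M (psi (- int k)) (act M (psi (int k)) v) = smul M (l k) v}"

definition weight_module :: "(fermion, 'v::ab_group_add) smod \<Rightarrow> bool" where
  "weight_module M \<longleftrightarrow> fermion.smodule M \<and> is_direct_sum (smul M) (carr M) (weight_space M)"

definition S_class :: "nat set \<Rightarrow> nat set set" where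
  "S_class I = {J. finite (I - J) \<and> finite (J - I)}"

definition xi_parity :: "nat set \<Rightarrow> nat set \<Rightarrow> bit" where
  "xi_parity I J = of_nat (card (I - J) + card (J - I))"

definition xi_sign :: "nat \<Rightarrow> nat set \<Rightarrow> complex" where
  "xi_sign k J = (- 1) ^ card {i \<in> J. i < k}"

fun xi_act :: "fgen \<Rightarrow> nat set \<Rightarrow> (nat set \<Rightarrow>\<^sub>0 complex)" where
  "xi_act (Psi m) J =
     (let k = nat \<bar>m\<bar> in
      if m > 0 then (if k \<in> J then pm_scale (xi_sign k J) (bvec (J - {k})) else 0)
      else if m < 0 then (if k \<notin> J then pm_scale (xi_sign k J) (bvec (J \<union> {k})) else 0)
      else pm_scale (1 / complex_of_real (sqrt 2)) (bvec (if 0 \<in> J then J - {0} else J \<union> {0})))"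
| "xi_act Zc J = bvec J"

text \<open>The module spanned by the \<open>\<xi>\<^sub>J = bvec J\<close> with \<open>J \<in> S\<^sub>I\<close>. It lives in the space with basis
  all subsets of \<open>\<nat>\<close>, on which the action does not depend on \<open>I\<close>.\<close>

definition V_mod :: "nat set \<Rightarrow> (fermion, nat set \<Rightarrow>\<^sub>0 complex) smod" where
  "V_mod I = \<lparr>
     carr = {f. Poly_Mapping.keys f \<subseteq> S_class I},
     smul = pm_scale,
     part = (\<lambda>p. {f. Poly_Mapping.keys f \<subseteq> {J \<in> S_class I. xi_parity I J = p}}),
     act = (\<lambda>x f. lin_ext pm_scale (\<lambda>a. lin_ext pm_scale (xi_act a) f) x)\<rparr>"

lemma S_class_update:
  assumes "J \<in> S_class I"
  shows "J - {k} \<in> S_class I" "J \<union> {k} \<in> S_class I"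
proof -
  have "I - (J - {k}) \<subseteq> insert k (I - J)" "J \<union> {k} - I \<subseteq> insert k (J - I)" by auto
  moreover have "J - {k} - I \<subseteq> J - I" "I - (J \<union> {k}) \<subseteq> I - J" by auto
  ultimately show "J - {k} \<in> S_class I" "J \<union> {k} \<in> S_class I"
    using assms unfolding S_class_def by (auto intro: finite_subset)
qed

lemma xi_parity_insert:
  assumes "J \<in> S_class I" "k \<notin> J"
  shows "xi_parity I (insert k J) = xi_parity I J + 1"
proof (cases "k \<in> I")
  case True
  have "I - J = insert k (I - insert k J)" "insert k J - I = J - I" using True assms by auto
  moreover have "finite (I - insert k J)" using assms by (auto simp: S_class_def intro: finite_subset[of _ "I - J"])
  ultimately have "card (I - J) = Suc (card (I - insert k J))"
    by (metis card_insert_disjoint DiffE insertI1)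
  then show ?thesis using \<open>insert k J - I = J - I\<close> by (simp add: xi_parity_def add_ac)
next
  case False
  have "I - insert k J = I - J" "insert k J - I = insert k (J - I)" using False assms by auto
  moreover have "finite (J - I)" using assms by (auto simp: S_class_def)
  ultimately show ?thesis using assms by (simp add: xi_parity_def add_ac)
qed

lemma xi_parity_remove:
  assumes "J \<in> S_class I" "k \<in> J"
  shows "xi_parity I (J - {k}) = xi_parity I J + 1"
  using xi_parity_insert[of "J - {k}" I k] S_class_update(1)[OF assms(1), of k] assms(2)
  by (simp add: insert_absorb add.assoc)

lemma xi_sign_insert:
  assumes "l \<notin> J"
  shows "xi_sign k (insert l J) = (if l < k then - 1 else 1) * xi_sign k J"
proof -
  have "{i \<in> insert l J. i < k} = (if l < k then insert l {i \<in> J. i < k} else {i \<in> J. i < k})"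
    by auto
  moreover have "finite {i \<in> J. i < k}" by (rule finite_subset[of _ "{..<k}"]) auto
  ultimately show ?thesis using assms by (simp add: xi_sign_def)
qed

definition xi_flip :: "nat \<Rightarrow> nat set \<Rightarrow> nat set" where
  "xi_flip k J = (if k \<in> J then J - {k} else insert k J)"

definition xi_coeff :: "int \<Rightarrow> nat set \<Rightarrow> complex" where
  "xi_coeff m J = (if m = 0 then 1 / complex_of_real (sqrt 2)
     else if 0 < m \<longleftrightarrow> nat \<bar>m\<bar> \<in> J then xi_sign (nat \<bar>m\<bar>) J else 0)"

lemma pm_scale_0 [simp]: "pm_scale 0 f = 0"
  by (rule poly_mapping_eqI) simp

lemma xi_act_Psi: "xi_act (Psi m) J = pm_scale (xi_coeff m J) (bvec (xi_flip (nat \<bar>m\<bar>) J))"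
  by (auto simp: xi_coeff_def xi_flip_def Let_def)

lemma xi_flip_mem: "i \<in> xi_flip k J \<longleftrightarrow> (if i = k then i \<notin> J else i \<in> J)"
  by (auto simp: xi_flip_def)

lemma xi_flip_flip: "xi_flip k (xi_flip k J) = J" "xi_flip k (xi_flip l J) = xi_flip l (xi_flip k J)"
  by (auto simp: set_eq_iff xi_flip_mem)

lemma xi_sign_flip: "xi_sign k (xi_flip l J) = (if l < k then - 1 else 1) * xi_sign k J"
  using xi_sign_insert[of l J k] xi_sign_insert[of l "J - {l}" k]
  by (auto simp: xi_flip_def insert_absorb split: if_splits)

lemma xi_sign_square: "xi_sign k J * xi_sign k J = 1"
  by (simp add: xi_sign_def flip: power_add)

lemma xi_coeff_flip:
  assumes "nat \<bar>m\<bar> \<noteq> l"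
  shows "xi_coeff m (xi_flip l J) = (if l < nat \<bar>m\<bar> then - 1 else 1) * xi_coeff m J"
  using assms by (auto simp: xi_coeff_def xi_flip_mem xi_sign_flip)

lemma xi_coeff_anticomm:
  "xi_coeff n J * xi_coeff m (xi_flip (nat \<bar>n\<bar>) J) + xi_coeff m J * xi_coeff n (xi_flip (nat \<bar>m\<bar>) J)
     = (if m = - n then 1 else 0)"
proof (cases "nat \<bar>m\<bar> = nat \<bar>n\<bar>")
  case False
  then have "m \<noteq> - n" by auto
  moreover have "nat \<bar>m\<bar> < nat \<bar>n\<bar> \<longleftrightarrow> \<not> nat \<bar>n\<bar> < nat \<bar>m\<bar>" using False by linarith
  ultimately show ?thesis
    using xi_coeff_flip[of m "nat \<bar>n\<bar>" J] xi_coeff_flip[of n "nat \<bar>m\<bar>" J] False by simp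
next
  case True
  then consider "m = 0" "n = 0" | "m \<noteq> 0" "n = m" | "m \<noteq> 0" "n = - m" by linarith
  then show ?thesis
  proof cases
    case 1
    have "complex_of_real (sqrt 2) * complex_of_real (sqrt 2) = 2"
      by (simp flip: of_real_mult)
    then show ?thesis using 1 by (simp add: xi_coeff_def)
  next
    case 2
    then show ?thesis by (simp add: xi_coeff_def xi_flip_mem)
  next
    case 3
    then have "(0 < n) \<longleftrightarrow> \<not> 0 < m" by linarith
    then show ?thesis using 3 xi_sign_square[of "nat \<bar>m\<bar>" J]
      by (cases "0 < m"; cases "nat \<bar>m\<bar> \<in> J") (simp_all add: xi_coeff_def xi_flip_mem xi_sign_flip)
  qed
qed

lemma V_mod_smodule: "fermion.smodule (V_mod I)"
proof -
  let ?C = "{f. Poly_Mapping.keys f \<subseteq> S_class I}"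
  let ?P = "\<lambda>p. {f :: nat set \<Rightarrow>\<^sub>0 complex. Poly_Mapping.keys f \<subseteq> {J \<in> S_class I. xi_parity I J = p}}"
  let ?a = "act (V_mod I)"
  have a_def: "?a x f = lin_ext pm_scale (\<lambda>a. lin_ext pm_scale (xi_act a) f) x" for x f
    by (simp add: V_mod_def)
  interpret P: vector_space "pm_scale :: complex \<Rightarrow> (nat set \<Rightarrow>\<^sub>0 complex) \<Rightarrow> _"
    by (rule vector_space_pm_scale)
  note vs = vector_space_pm_scale
  have bil: "?a (x + y) f = ?a x f + ?a y f" "?a (pm_scale c x) f = pm_scale c (?a x f)"
    "?a x (f + g) = ?a x f + ?a x g" "?a x (pm_scale c f) = pm_scale c (?a x f)" for x y f g c
    by (simp_all add: a_def lin_ext_add[OF vs] lin_ext_scale[OF vs] lin_ext_fun_add[OF vs]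
        lin_ext_fun_scale[OF vs])
  have bas: "?a (bvec a) (bvec J) = xi_act a J" for a J
    by (simp add: a_def lin_ext_single[OF vs])
  have zero: "?a 0 f = 0" "?a x 0 = 0" for x f by (simp_all add: a_def lin_ext_def)
  have ds: "is_direct_sum pm_scale ?C ?P" by (rule is_direct_sum_parity)
  then have subC: "P.subspace ?C" and subP: "P.subspace (?P p)" for p
    by (simp_all add: is_direct_sum_def)
  note clo = P.subspace_0[OF subP] P.subspace_add[OF subP] P.subspace_scale[OF subP]
  have bvP: "bvec J \<in> ?P p \<longleftrightarrow> J \<in> S_class I \<and> xi_parity I J = p" for J p by simp
  have flipS: "xi_flip k J \<in> S_class I \<and> xi_parity I (xi_flip k J) = xi_parity I J + 1"
    if "J \<in> S_class I" for k J
    using S_class_update[OF that, of k] xi_parity_insert[OF that, of k] xi_parity_remove[OF that, of k]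
    by (simp add: xi_flip_def)
  have xiP: "xi_act a J \<in> ?P (fgen_parity a + xi_parity I J)" if "J \<in> S_class I" for a J
  proof (cases a)
    case (Psi m)
    show ?thesis unfolding Psi xi_act_Psi
      by (rule P.subspace_scale[OF subP]) (use flipS[OF that] in \<open>simp add: add.commute\<close>)
  qed (use that in simp)
  have grade: "?a x v \<in> ?P (p + q)" if x: "x \<in> fermion_gr p" and v: "v \<in> ?P q" for x v p q
  proof -
    have "Poly_Mapping.keys x \<subseteq> {a. fgen_parity a = p}" using x by (auto simp: fermion_gr_def)
    then show ?thesis
    proof (induction x rule: pm_induct)
      case (basis a)
      have "Poly_Mapping.keys v \<subseteq> {J \<in> S_class I. xi_parity I J = q}" using v by simp
      then show ?case
      proof (induction v rule: pm_induct)
        case (basis J)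
        then show ?case using xiP[of J a] \<open>a \<in> _\<close> unfolding bas by blast
      qed (simp_all only: zero bil clo)
    qed (simp_all only: zero bil clo)
  qed
  have carrC: "?a x v \<in> ?C" if v: "v \<in> ?C" for x v
  proof -
    note clo = P.subspace_0[OF subC] P.subspace_add[OF subC] P.subspace_scale[OF subC]
    have "Poly_Mapping.keys x \<subseteq> UNIV" by simp
    then show ?thesis
    proof (induction x rule: pm_induct)
      case (basis a)
      have "Poly_Mapping.keys v \<subseteq> S_class I" using v by simp
      then show ?case
      proof (induction v rule: pm_induct)
        case (basis J)
        then show ?case using xiP[of J a] unfolding bas by blast
      qed (simp_all only: zero bil clo)
    qed (simp_all only: zero bil clo)
  qed
  have zx: "?a zel f = f" for f
  proof -
    have "Poly_Mapping.keys f \<subseteq> UNIV" by simp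
    then show ?thesis by (induction f rule: pm_induct) (simp_all add: bil bas zero)
  qed
  have comm: "?a x (?a zel f) = ?a zel (?a x f)" for x f by (simp add: zx)
  have br: "?a (fermion_br x y) v = ?a x (?a y v) - pm_scale (koszul p q) (?a y (?a x v))"
    if x: "x \<in> fermion_gr p" and y: "y \<in> fermion_gr q" for x y v p q
  proof -
    have "Poly_Mapping.keys x \<subseteq> {a. fgen_parity a = p}" using x by (auto simp: fermion_gr_def)
    then show ?thesis
    proof (induction x rule: pm_induct)
      case (basis a)
      have "Poly_Mapping.keys y \<subseteq> {a. fgen_parity a = q}" using y by (auto simp: fermion_gr_def)
      then show ?case
      proof (induction y rule: pm_induct)
        case (basis b)
        have "Poly_Mapping.keys v \<subseteq> UNIV" by simp
        then show ?case
        proof (induction v rule: pm_induct)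
          case (basis J)
          show ?case
          proof (cases "(a, b)" rule: fgen_br.cases)
            case (1 m n)
            have pq: "p = 1" "q = 1" using 1 \<open>a \<in> _\<close> \<open>b \<in> _\<close> by auto
            have e: "?a (psi k) (?a (psi l) (bvec J)) =
                pm_scale (xi_coeff l J * xi_coeff k (xi_flip (nat \<bar>l\<bar>) J))
                  (bvec (xi_flip (nat \<bar>k\<bar>) (xi_flip (nat \<bar>l\<bar>) J)))" for k l
              by (simp add: bas xi_act_Psi bil del: xi_act.simps)
            have "?a (psi m) (?a (psi n) (bvec J)) - pm_scale (koszul p q) (?a (psi n) (?a (psi m) (bvec J)))
              = pm_scale (if m = - n then 1 else 0) (bvec (xi_flip (nat \<bar>m\<bar>) (xi_flip (nat \<bar>n\<bar>) J)))"
              unfolding e xi_coeff_anticomm[of n J m, symmetric]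
              by (simp add: pq koszul_def P.scale_left_distrib xi_flip_flip(2)[of "nat \<bar>n\<bar>" "nat \<bar>m\<bar>"])
            also have "\<dots> = ?a (fgen_br (Psi m) (Psi n)) (bvec J)"
              by (simp add: zx zero xi_flip_flip(1))
            finally show ?thesis using 1 by (simp add: fermion_br_basis)
          qed (use \<open>a \<in> _\<close> \<open>b \<in> _\<close> in \<open>auto simp: fermion_br_basis koszul_def zx zero\<close>)
        qed (simp_all add: zero bil P.scale_right_distrib P.scale_right_diff_distrib mult.commute)
      qed (simp_all add: zero bil fermion_br_add_right fermion_br_scale_right P.scale_right_distrib
          P.scale_right_diff_distrib mult.commute)
    qed (simp_all add: zero bil fermion_br_add_left fermion_br_scale_left P.scale_right_distrib
          P.scale_right_diff_distrib mult.commute)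
  qed
  have f: "carr (V_mod I) = ?C" "smul (V_mod I) = pm_scale" "part (V_mod I) = ?P"
    by (simp_all add: V_mod_def)
  show ?thesis
    unfolding fermion.smodule_def f
    by (intro conjI allI impI ballI vs ds grade carrC bil br) assumption+
qed

end

theory Submission
  imports Defs
begin

text \<open>The operators \<open>\<psi>\<^bsub>k\<^esub> + \<psi>\<^bsub>-k\<^esub>\<close> (for \<open>k \<ge> 1\<close>) and
  \<open>\<surd>2 \<psi>\<^sub>0\<close> are anticommuting involutions, and a homogeneous weight vector \<open>v\<close> is
  annihilated by \<open>\<psi>\<^bsub>-k\<^esub>\<close> or by \<open>\<psi>\<^bsub>k\<^esub>\<close> according to whether
  \<open>\<lambda>\<^sub>k\<close> is \<open>1\<close> or \<open>0\<close>. With \<open>I = {k \<ge> 1. \<lambda>\<^sub>k = 1}\<close>, applying the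
  involutions to \<open>v\<close> yields vectors on which the algebra acts as on the \<open>\<xi>\<^sub>J\<close>, hence a
  homomorphism from the model module onto \<open>U(F) v\<close>. It is injective because the images of the
  \<open>\<xi>\<^sub>J\<close> are nonzero and separated by weight and parity. A simple module contains an even weight
  vector, since \<open>\<psi>\<^sub>0\<close> changes the parity but not the weight.\<close>

section \<open>Direct sums and coordinate projections\<close>

text \<open>Both \<open>single i v\<close> and \<open>single j v\<close> decompose \<open>v\<close>,
  so uniqueness makes them equal; comparing the entries at \<open>i\<close> gives the claim.\<close>

lemma is_direct_sum_disjoint:
  fixes W :: "'i \<Rightarrow> 'v::ab_group_add set"
  assumes s: "vector_space s" and ds: "is_direct_sum s V W"
    and v: "v \<in> W i" "v \<in> W j" and ij: "i \<noteq> j"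
  shows "v = 0"
proof -
  interpret vector_space s by fact
  have zero: "0 \<in> W k" for k
    using ds subspace_0 unfolding is_direct_sum_def by blast
  have "v \<in> V" using ds v unfolding is_direct_sum_def by blast
  then have ex: "\<exists>!f :: 'i \<Rightarrow>\<^sub>0 'v. (\<forall>i. Poly_Mapping.lookup f i \<in> W i) \<and>
        v = (\<Sum>i\<in>Poly_Mapping.keys f. Poly_Mapping.lookup f i)"
    using ds unfolding is_direct_sum_def by blast
  have "(\<forall>n. Poly_Mapping.lookup (Poly_Mapping.single k v) n \<in> W n) \<and>
        v = (\<Sum>n\<in>Poly_Mapping.keys (Poly_Mapping.single k v). Poly_Mapping.lookup (Poly_Mapping.single k v) n)"
    if "v \<in> W k" for k
    using that zero by (auto simp: lookup_single when_def)
  then have "Poly_Mapping.single i v = Poly_Mapping.single j v"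
    using ex v by blast
  then have "Poly_Mapping.lookup (Poly_Mapping.single i v) i = Poly_Mapping.lookup (Poly_Mapping.single j v) i"
    by simp
  then show ?thesis using ij by (simp add: lookup_single)
qed

text \<open>The parities are written \<open>q\<close> and \<open>q + 1\<close> so that the component
  of any prescribed parity can be named first.\<close>

lemma is_direct_sum_bitE:
  fixes P :: "bit \<Rightarrow> 'v::ab_group_add set"
  assumes ds: "is_direct_sum s V P" and v: "v \<in> V"
  obtains a b where "a \<in> P q" "b \<in> P (q + 1)" "v = a + b"
proof -
  obtain f :: "bit \<Rightarrow>\<^sub>0 'v" where f: "\<And>i. Poly_Mapping.lookup f i \<in> P i"
    "v = (\<Sum>i\<in>Poly_Mapping.keys f. Poly_Mapping.lookup f i)"
    using ds v unfolding is_direct_sum_def by blast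
  have univ: "(UNIV :: bit set) = {q, q + 1}" by (cases q) auto
  have "Poly_Mapping.keys f \<subseteq> {q, q + 1}" unfolding univ[symmetric] by (rule subset_UNIV)
  then have "v = (\<Sum>i\<in>{q, q + 1}. Poly_Mapping.lookup f i)"
    unfolding f(2) by (intro sum.mono_neutral_left ballI) (simp_all add: in_keys_iff del: insert_iff)
  then have "v = Poly_Mapping.lookup f q + Poly_Mapping.lookup f (q + 1)" by (cases q) simp_all
  then show ?thesis using that f(1) by blast
qed

definition restrict_pm :: "'a set \<Rightarrow> ('a \<Rightarrow>\<^sub>0 complex) \<Rightarrow> ('a \<Rightarrow>\<^sub>0 complex)" where
  "restrict_pm A f = Poly_Mapping.mapp (\<lambda>a c. if a \<in> A then c else 0) f"

lemma lookup_restrict_pm: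
  "Poly_Mapping.lookup (restrict_pm A f) a = (if a \<in> A then Poly_Mapping.lookup f a else 0)"
  by (simp add: restrict_pm_def lookup_mapp when_def in_keys_iff)

lemma keys_restrict_pm: "Poly_Mapping.keys (restrict_pm A f) = Poly_Mapping.keys f \<inter> A"
  by (auto simp: in_keys_iff lookup_restrict_pm split: if_splits)

lemma restrict_pm_split: "f = restrict_pm A f + restrict_pm (- A) f"
  by (rule poly_mapping_eqI) (simp add: lookup_add lookup_restrict_pm)

lemma restrict_pm_linear:
  "restrict_pm A 0 = 0"
  "restrict_pm A (f + g) = restrict_pm A f + restrict_pm A g"
  "restrict_pm A (pm_scale c f) = pm_scale c (restrict_pm A f)"
  "restrict_pm A (bvec a) = (if a \<in> A then bvec a else 0)"
  by (auto intro!: poly_mapping_eqI simp: lookup_add lookup_restrict_pm lookup_single when_def)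

text \<open>Shortest-vector argument by induction on the size of the support: a separating
  \<open>A\<close> cuts off at least one and keeps at least one of two support points, so the
  restriction is nonzero with smaller support. Applied to the kernel of a linear map, it yields
  injectivity.\<close>

lemma trivial_if_separating_restrictions:
  assumes single: "\<And>a c. Poly_Mapping.single a c \<in> K \<Longrightarrow> c = 0"
    and sep: "\<And>f a b. f \<in> K \<Longrightarrow> a \<in> Poly_Mapping.keys f \<Longrightarrow> b \<in> Poly_Mapping.keys f \<Longrightarrow> a \<noteq> b \<Longrightarrow>
      \<exists>A. (a \<in> A) \<noteq> (b \<in> A) \<and> restrict_pm A f \<in> K"
    and f: "f \<in> K"
  shows "f = 0"
  using f
proof (induction "card (Poly_Mapping.keys f)" arbitrary: f rule: less_induct)
  case less
  show ?case
  proof (rule ccontr)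
    assume "f \<noteq> 0"
    then obtain a where a: "a \<in> Poly_Mapping.keys f" by fastforce
    show False
    proof (cases "Poly_Mapping.keys f = {a}")
      case True
      have "f = Poly_Mapping.single a (Poly_Mapping.lookup f a)"
        using True by (intro poly_mapping_eqI) (auto simp: lookup_single when_def in_keys_iff)
      then have "Poly_Mapping.lookup f a = 0" using single less.prems by metis
      then show False using a by (simp add: in_keys_iff)
    next
      case False
      then obtain b where b: "b \<in> Poly_Mapping.keys f" "a \<noteq> b" using a by blast
      obtain A where A: "(a \<in> A) \<noteq> (b \<in> A)" "restrict_pm A f \<in> K"
        using sep[OF less.prems a b] by blast
      have "Poly_Mapping.keys f \<inter> A \<subset> Poly_Mapping.keys f" using A a b by blast
      then have "card (Poly_Mapping.keys (restrict_pm A f)) < card (Poly_Mapping.keys f)"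
        by (simp add: keys_restrict_pm psubset_card_mono)
      then have "restrict_pm A f = 0" using less.hyps A by blast
      then have "Poly_Mapping.keys f \<inter> A = {}" using keys_restrict_pm[of A f] by simp
      then show False using A a b by blast
    qed
  qed
qed

section \<open>Modules, embeddings and cyclic submodules\<close>

context lie_superalgebra
begin

lemma smodule_vs: "smodule M \<Longrightarrow> vector_space (smul M)"
  by (simp add: smodule_def)

lemma smodule_ds: "smodule M \<Longrightarrow> is_direct_sum (smul M) (carr M) (part M)"
  by (simp add: smodule_def)

lemma smodule_subspace:
  assumes "smodule M"
  shows "module.subspace (smul M) (carr M)" "module.subspace (smul M) (part M q)"
  using smodule_ds[OF assms] by (simp_all add: is_direct_sum_def)

lemma part_subset_carr: "smodule M \<Longrightarrow> v \<in> part M q \<Longrightarrow> v \<in> carr M"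
  using smodule_ds unfolding is_direct_sum_def by blast

lemma smodule_act:
  assumes "smodule M"
  shows "x \<in> gr q \<Longrightarrow> v \<in> part M r \<Longrightarrow> act M x v \<in> part M (q + r)"
    and "v \<in> carr M \<Longrightarrow> act M x v \<in> carr M"
    and "v \<in> carr M \<Longrightarrow> act M (x + y) v = act M x v + act M y v"
    and "v \<in> carr M \<Longrightarrow> act M (scale c x) v = smul M c (act M x v)"
    and "v \<in> carr M \<Longrightarrow> w \<in> carr M \<Longrightarrow> act M x (v + w) = act M x v + act M x w"
    and "v \<in> carr M \<Longrightarrow> act M x (smul M c v) = smul M c (act M x v)"
    and "x \<in> gr q \<Longrightarrow> y \<in> gr r \<Longrightarrow> v \<in> carr M \<Longrightarrow>
      act M (br x y) v = act M x (act M y v) - smul M (koszul q r) (act M y (act M x v))"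
  using assms unfolding smodule_def by simp_all

lemma smodule_closed:
  assumes "smodule M"
  shows "0 \<in> carr M" "v \<in> carr M \<Longrightarrow> w \<in> carr M \<Longrightarrow> v + w \<in> carr M"
    "v \<in> carr M \<Longrightarrow> w \<in> carr M \<Longrightarrow> v - w \<in> carr M" "v \<in> carr M \<Longrightarrow> smul M c v \<in> carr M"
    "0 \<in> part M q" "v \<in> part M q \<Longrightarrow> w \<in> part M q \<Longrightarrow> v + w \<in> part M q"
    "v \<in> part M q \<Longrightarrow> w \<in> part M q \<Longrightarrow> v - w \<in> part M q" "v \<in> part M q \<Longrightarrow> smul M c v \<in> part M q"
proof -
  interpret S: vector_space "smul M" by (rule smodule_vs[OF assms])
  note sub = smodule_subspace[OF assms]
  show "0 \<in> carr M" "v \<in> carr M \<Longrightarrow> w \<in> carr M \<Longrightarrow> v + w \<in> carr M"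
    "v \<in> carr M \<Longrightarrow> w \<in> carr M \<Longrightarrow> v - w \<in> carr M" "v \<in> carr M \<Longrightarrow> smul M c v \<in> carr M"
    "0 \<in> part M q" "v \<in> part M q \<Longrightarrow> w \<in> part M q \<Longrightarrow> v + w \<in> part M q"
    "v \<in> part M q \<Longrightarrow> w \<in> part M q \<Longrightarrow> v - w \<in> part M q" "v \<in> part M q \<Longrightarrow> smul M c v \<in> part M q"
    by (rule S.subspace_0[OF sub(1)] S.subspace_add[OF sub(1)] S.subspace_diff[OF sub(1)]
        S.subspace_scale[OF sub(1)] S.subspace_0[OF sub(2)] S.subspace_add[OF sub(2)]
        S.subspace_diff[OF sub(2)] S.subspace_scale[OF sub(2)]; assumption)+
qed

lemma smodule_act_zero:
  assumes "smodule M"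
  shows "act M x 0 = 0" and "v \<in> carr M \<Longrightarrow> act M 0 v = 0"
  using smodule_act(5)[OF assms, of 0 0 x] smodule_act(3)[OF assms, of v 0 0]
    smodule_closed(1)[OF assms] by simp_all

lemma smodule_act_diff:
  assumes "smodule M" "v \<in> carr M" "w \<in> carr M"
  shows "act M x (v - w) = act M x v - act M x w"
  using smodule_act(5)[OF assms(1) smodule_closed(3)[OF assms] assms(3), of x] by simp

lemma part_disjoint:
  assumes "smodule M" "v \<in> part M q" "v \<in> part M r" "q \<noteq> r"
  shows "v = 0"
  using is_direct_sum_disjoint[OF smodule_vs smodule_ds] assms by blast

lemma part_sum_zero:
  assumes M: "smodule M" and "v \<in> part M q" "w \<in> part M r" "q \<noteq> r" "v + w = 0"
  shows "v = 0" "w = 0"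
proof -
  have "v = 0 - w" using assms(5) by (simp add: eq_neg_iff_add_eq_0)
  then have "v \<in> part M r" using smodule_closed(5,7)[OF M] assms(3) by metis
  then show "v = 0" using part_disjoint assms by blast
  then show "w = 0" using assms(5) by simp
qed

text \<open>Homomorphisms are easily built out of a module with a known basis, while the isomorphism
  sought points towards that module; hence the inverse. It has the same parity \<open>d\<close>,
  since \<open>d + d = 0\<close>. The result includes that the image is a graded submodule.\<close>

lemma iso_inverse_of_embedding:
  assumes M: "smodule M" and N: "smodule N" and inj: "inj_on \<theta> (carr N)"
    and sub: "\<And>f. f \<in> carr N \<Longrightarrow> \<theta> f \<in> carr M"
    and add: "\<And>f g. f \<in> carr N \<Longrightarrow> g \<in> carr N \<Longrightarrow> \<theta> (f + g) = \<theta> f + \<theta> g"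
    and scl: "\<And>c f. f \<in> carr N \<Longrightarrow> \<theta> (smul N c f) = smul M c (\<theta> f)"
    and act: "\<And>x f. f \<in> carr N \<Longrightarrow> \<theta> (act N x f) = act M x (\<theta> f)"
    and par: "\<And>q f. f \<in> part N q \<Longrightarrow> \<theta> f \<in> part M (q + d)"
  shows "smod_iso d (sub_smod M (\<theta> ` carr N)) N (inv_into (carr N) \<theta>)"
proof -
  interpret S: vector_space "smul M" by (rule smodule_vs[OF M])
  let ?W = "\<theta> ` carr N" and ?\<phi> = "inv_into (carr N) \<theta>"
  note mem = smodule_closed[OF N] smodule_act(2)[OF N]
  have dd: "q + d + d = q" for q :: bit by (cases q; cases d) simp_all
  have inv: "?\<phi> (\<theta> f) = f" if "f \<in> carr N" for f using inj that by simp
  have partW: "part M (q + d) \<inter> ?W = \<theta> ` part N q" for q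
  proof
    show "\<theta> ` part N q \<subseteq> part M (q + d) \<inter> ?W" using par part_subset_carr[OF N] by blast
    show "part M (q + d) \<inter> ?W \<subseteq> \<theta> ` part N q"
    proof
      fix w assume w: "w \<in> part M (q + d) \<inter> ?W"
      then obtain f where f: "f \<in> carr N" "w = \<theta> f" by blast
      obtain a b where ab: "a \<in> part N q" "b \<in> part N (q + 1)" "f = a + b"
        using is_direct_sum_bitE[OF smodule_ds[OF N] f(1)] by blast
      have c: "a \<in> carr N" "b \<in> carr N" using ab part_subset_carr[OF N] by blast+
      \<comment> \<open>The component \<open>b\<close> of the wrong parity is sent into both parts
        of \<open>M\<close>, hence to 0.\<close>
      have e: "w = \<theta> a + \<theta> b" using add c ab f by simp
      then have "\<theta> b = w - \<theta> a" by simp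
      then have "\<theta> b \<in> part M (q + d)" using smodule_closed(7)[OF M] w par[OF ab(1)] by auto
      moreover have "\<theta> b \<in> part M (q + 1 + d)" using par ab by blast
      moreover have "q + d \<noteq> q + 1 + d" by (cases q; cases d) simp_all
      ultimately have "\<theta> b = 0" using part_disjoint[OF M] by blast
      then show "w \<in> \<theta> ` part N q" using e ab by simp
    qed
  qed
  have W_sub: "S.subspace ?W"
  proof (rule S.subspaceI)
    have "\<theta> 0 = 0" using add[of 0 0] mem(1) by simp
    then show "0 \<in> ?W" using mem(1) by (metis imageI)
    show "x + y \<in> ?W" if "x \<in> ?W" "y \<in> ?W" for x y
      using that mem(2) by (auto simp flip: add)
    show "smul M c x \<in> ?W" if "x \<in> ?W" for c x
      using that mem(4) by (auto simp flip: scl)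
  qed
  have ds: "is_direct_sum (smul M) ?W (\<lambda>q. part M q \<inter> ?W)"
  proof (rule is_direct_sum_bitI[OF smodule_vs[OF M]])
    show "S.subspace (part M q \<inter> ?W)" for q
      by (rule S.subspace_inter[OF smodule_subspace(2)[OF M] W_sub])
    show "w = 0" if "w \<in> part M 0 \<inter> ?W" "w \<in> part M 1 \<inter> ?W" for w
      using that part_disjoint[OF M, of w 0 1] by simp
    show "?W = {v + w |v w. v \<in> part M 0 \<inter> ?W \<and> w \<in> part M 1 \<inter> ?W}" (is "_ = ?R")
    proof
      show "?R \<subseteq> ?W" using S.subspace_add[OF W_sub] by blast
      show "?W \<subseteq> ?R"
      proof
        fix w assume "w \<in> ?W"
        then obtain f where f: "f \<in> carr N" "w = \<theta> f" by blast
        \<comment> \<open>Since \<open>\<theta>\<close> shifts parities by \<open>d\<close>, the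
          component of parity \<open>d\<close> gives the even summand of \<open>w\<close>.\<close>
        obtain a b where ab: "a \<in> part N d" "b \<in> part N (d + 1)" "f = a + b"
          using is_direct_sum_bitE[OF smodule_ds[OF N] f(1)] by blast
        have c: "a \<in> carr N" "b \<in> carr N" using ab part_subset_carr[OF N] by blast+
        have "\<theta> a \<in> part M (d + d)" "\<theta> b \<in> part M (d + 1 + d)" using par ab by blast+
        moreover have "d + d = 0" "d + 1 + d = 1" by (cases d; simp)+
        ultimately have "\<theta> a \<in> part M 0 \<inter> ?W \<and> \<theta> b \<in> part M 1 \<inter> ?W" using c by simp
        moreover have "w = \<theta> a + \<theta> b" using add c ab f by simp
        ultimately show "w \<in> ?R" by blast
      qed
    qed
  qed
  have acts: "act M x w \<in> ?W" if "w \<in> ?W" for x w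
    using that mem(9) by (auto simp flip: act)
  have WM: "?W \<subseteq> carr M" using sub by blast
  have sm: "smodule (sub_smod M ?W)"
  proof -
    have WM': "w \<in> carr M" if "w \<in> ?W" for w using that WM by blast
    have f: "carr (sub_smod M ?W) = ?W" "smul (sub_smod M ?W) = smul M" "act (sub_smod M ?W) = act M"
      "part (sub_smod M ?W) = (\<lambda>q. part M q \<inter> ?W)" by (simp_all add: sub_smod_def)
    have gr: "act M x w \<in> part M (q + r) \<inter> ?W" if "x \<in> gr q" "w \<in> part M r \<inter> ?W" for x w q r
      using smodule_act(1)[OF M that(1)] acts that(2) by blast
    show ?thesis
      unfolding smodule_def f
      by (intro conjI allI impI ballI smodule_vs[OF M] ds gr acts smodule_act(3-7)[OF M] WM') assumption+
  qed
  have bij: "bij_betw ?\<phi> ?W (carr N)"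
    using inj by (simp add: bij_betw_inv_into inj_on_imp_bij_betw)
  have \<phi>_part: "?\<phi> ` (part M q \<inter> ?W) = part N (q + d)" for q
  proof -
    have "?\<phi> ` (part M q \<inter> ?W) = ?\<phi> ` \<theta> ` part N (q + d)"
      using partW[of "q + d"] by (simp only: dd)
    also have "\<dots> = part N (q + d)"
      using inv part_subset_carr[OF N] by (force simp: image_iff)
    finally show ?thesis .
  qed
  show ?thesis
    unfolding smod_iso_def
  proof (intro conjI allI ballI sm N)
    show "bij_betw ?\<phi> (carr (sub_smod M ?W)) (carr N)" using bij by (simp add: sub_smod_def)
    show "?\<phi> ` part (sub_smod M ?W) q = part N (q + d)" for q
      using \<phi>_part by (simp add: sub_smod_def)
    fix v assume v: "v \<in> carr (sub_smod M ?W)"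
    then obtain f where f: "f \<in> carr N" "v = \<theta> f" by (auto simp: sub_smod_def)
    show "?\<phi> (smul (sub_smod M ?W) c v) = smul N c (?\<phi> v)" for c
      using f inv[OF f(1)] inv[OF mem(4)[OF f(1)]] scl[OF f(1)] by (simp add: sub_smod_def)
    show "?\<phi> (act (sub_smod M ?W) x v) = act N x (?\<phi> v)" for x
      using f inv[OF f(1)] inv[OF mem(9)[OF f(1)]] act[OF f(1)] by (simp add: sub_smod_def)
    fix w assume w: "w \<in> carr (sub_smod M ?W)"
    then obtain g where g: "g \<in> carr N" "w = \<theta> g" by (auto simp: sub_smod_def)
    show "?\<phi> (v + w) = ?\<phi> v + ?\<phi> w"
      using f g inv[OF f(1)] inv[OF g(1)] inv[OF mem(2)[OF f(1) g(1)]] add[OF f(1) g(1)] by simp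
  qed
qed

lemma U_orbit_subspace:
  assumes M: "smodule M" and v: "v \<in> carr M"
  shows "module.subspace (smul M) (U_orbit M v)"
proof -
  note vs = smodule_vs[OF M]
  interpret S: vector_space "smul M" by (rule vs)
  have "free_act M 0 v = 0" by (simp add: free_act_def lin_ext_def)
  then have zero: "0 \<in> range (\<lambda>t. free_act M t v)" by (metis rangeI)
  have "free_act M s v + free_act M t v = free_act M (s + t) v"
    "smul M c (free_act M s v) = free_act M (pm_scale c s) v" for s t c
    by (simp_all add: free_act_def lin_ext_add[OF vs] lin_ext_scale[OF vs])
  then show ?thesis
    unfolding U_orbit_eq[OF M v] by (intro S.subspaceI zero) auto
qed

lemma U_orbit_self:
  assumes M: "smodule M" and v: "v \<in> carr M"
  shows "v \<in> U_orbit M v"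
proof -
  interpret S: vector_space "smul M" by (rule smodule_vs[OF M])
  have "free_act M (bvec []) v = v"
    by (simp add: free_act_def lin_ext_single[OF smodule_vs[OF M]])
  then show ?thesis unfolding U_orbit_eq[OF M v] by (metis rangeI)
qed

lemma free_act_carr:
  assumes M: "smodule M" and v: "v \<in> carr M"
  shows "free_act M t v \<in> carr M"
proof -
  interpret S: vector_space "smul M" by (rule smodule_vs[OF M])
  show ?thesis unfolding free_act_def lin_ext_def
    by (intro S.subspace_sum[OF smodule_subspace(1)[OF M]] smodule_closed(4)[OF M] foldr_act_carr[OF M v])
qed

text \<open>On words, acting by \<open>x\<close> prefixes the letter \<open>x\<close>; linearity
  extends this to the whole free algebra.\<close>

lemma U_orbit_act:
  assumes M: "smodule M" and v: "v \<in> carr M" and w: "w \<in> U_orbit M v"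
  shows "act M x w \<in> U_orbit M v"
proof -
  note vs = smodule_vs[OF M] note sub = U_orbit_subspace[OF M v]
  interpret S: vector_space "smul M" by (rule vs)
  have F: "free_act M 0 v = 0" "free_act M (bvec xs) v = foldr (act M) xs v"
    "free_act M (s + t) v = free_act M s v + free_act M t v"
    "free_act M (pm_scale c s) v = smul M c (free_act M s v)" for s t c xs
    by (simp_all add: free_act_def lin_ext_def[of _ _ 0] lin_ext_single[OF vs] lin_ext_add[OF vs]
        lin_ext_scale[OF vs])
  obtain t where w: "w = free_act M t v" using w unfolding U_orbit_eq[OF M v] by blast
  have "Poly_Mapping.keys t \<subseteq> UNIV" by simp
  then have "act M x (free_act M t v) \<in> U_orbit M v"
  proof (induction t rule: pm_induct)
    case zero
    then show ?case using S.subspace_0[OF sub] by (simp add: F smodule_act_zero[OF M])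
  next
    case (add s t)
    then show ?case using S.subspace_add[OF sub]
      by (simp add: F smodule_act(5)[OF M free_act_carr[OF M v] free_act_carr[OF M v]])
  next
    case (scale c s)
    then show ?case using S.subspace_scale[OF sub]
      by (simp add: F smodule_act(6)[OF M free_act_carr[OF M v]])
  next
    case (basis xs)
    have "act M x (free_act M (bvec xs) v) = free_act M (bvec (x # xs)) v" by (simp only: F) simp
    then show ?case unfolding U_orbit_eq[OF M v] by blast
  qed
  then show ?thesis using w by simp
qed

text \<open>Every word in the generators keeps \<open>v\<close> inside \<open>W\<close>, and so do
  linear combinations. This bounds the orbit by the image of the model.\<close>

lemma U_orbit_minimal:
  assumes M: "smodule M" and v: "v \<in> carr M" and W: "module.subspace (smul M) W" "v \<in> W"
    and act: "\<And>x w. w \<in> W \<Longrightarrow> act M x w \<in> W"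
  shows "U_orbit M v \<subseteq> W"
proof -
  interpret S: vector_space "smul M" by (rule smodule_vs[OF M])
  have "foldr (act M) xs v \<in> W" for xs by (induction xs) (simp_all add: W act)
  then have "free_act M t v \<in> W" for t
    unfolding free_act_def lin_ext_def by (intro S.subspace_sum[OF W(1)] S.subspace_scale[OF W(1)])
  then show ?thesis unfolding U_orbit_eq[OF M v] by blast
qed

end

section \<open>Weight spaces when the central element acts as the identity\<close>

lemma psi_gr: "psi m \<in> fermion_gr 1"
  by (simp add: fermion_gr_def)

locale unital_fermion_module =
  fixes V :: "(fermion, 'v::ab_group_add) smod"
  assumes M: "fermion.smodule V" and unital: "\<And>w. w \<in> carr V \<Longrightarrow> act V zel w = w"
begin

sublocale S: vector_space "smul V"
  by (rule fermion.smodule_vs[OF M])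

abbreviation sc (infixr "\<cdot>" 75) where "c \<cdot> w \<equiv> smul V c w"
abbreviation ac (infixr "\<star>" 76) where "x \<star> w \<equiv> act V x w"

lemmas closed [simp] = fermion.smodule_closed[OF M] fermion.smodule_act(2)[OF M]
lemmas act_linear = fermion.smodule_act(3-6)[OF M] fermion.smodule_act_zero[OF M]
  fermion.smodule_act_diff[OF M]

text \<open>For odd elements the Koszul sign turns the module axiom for the bracket into an
  anticommutation relation, and \<open>zel\<close> disappears because it acts as the
  identity.\<close>

lemma odd_anticomm:
  assumes "x \<in> fermion_gr 1" "y \<in> fermion_gr 1" "fermion_br x y = pm_scale c zel" "w \<in> carr V"
  shows "x \<star> y \<star> w = c \<cdot> w - y \<star> x \<star> w"
  using fermion.smodule_act(7)[OF M assms(1,2,4)] assms(4)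
  by (simp add: assms(3) koszul_def act_linear unital)

lemma psi_anticomm:
  assumes "w \<in> carr V"
  shows "psi m \<star> psi n \<star> w = (if m = - n then w else 0) - psi n \<star> psi m \<star> w"
proof -
  have "fermion_br (psi m) (psi n) = pm_scale (if m = - n then 1 else 0) zel"
    by (auto simp: fermion_br_basis intro: poly_mapping_eqI)
  from odd_anticomm[OF psi_gr psi_gr this assms] show ?thesis by simp
qed

text \<open>The type \<open>'v\<close> is only an abelian group, so halving goes through the complex
  scalars.\<close>

lemma double_eq_0: "w = - w \<Longrightarrow> w = 0" for w :: 'v
proof -
  assume "w = - w"
  then have "w + w = 0" by (metis add.right_inverse)
  then have "2 \<cdot> w = 0" using S.scale_left_distrib[of 1 1 w] by simp
  then show ?thesis by simp
qed

lemma psi_square: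
  assumes "w \<in> carr V" "m \<noteq> 0"
  shows "psi m \<star> psi m \<star> w = 0"
  using psi_anticomm[OF assms(1), of m m] assms(2) by (intro double_eq_0) simp

lemma psi0_square:
  assumes "w \<in> carr V"
  shows "psi 0 \<star> psi 0 \<star> w = (1 / 2) \<cdot> w"
proof -
  have "psi 0 \<star> psi 0 \<star> w + psi 0 \<star> psi 0 \<star> w = w"
    using psi_anticomm[OF assms, of 0 0] by (simp add: eq_diff_eq)
  then have "2 \<cdot> (psi 0 \<star> psi 0 \<star> w) = w"
    using S.scale_left_distrib[of 1 1 "psi 0 \<star> psi 0 \<star> w"] by simp
  then show ?thesis by (metis S.scale_scale S.scale_one nonzero_divide_eq_eq zero_neq_numeral)
qed

text \<open>\<open>psi m\<close> anticommutes with both factors, and the two signs cancel.\<close>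

lemma psi_commutes_even:
  assumes w: "w \<in> carr V" and m: "m \<noteq> n" "m \<noteq> - n"
  shows "psi (- n) \<star> psi n \<star> psi m \<star> w = psi m \<star> psi (- n) \<star> psi n \<star> w"
proof -
  have "psi n \<star> psi m \<star> w = 0 - psi m \<star> psi n \<star> w"
    using psi_anticomm[OF w, of n m] m by auto
  then have "psi (- n) \<star> psi n \<star> psi m \<star> w = 0 - psi (- n) \<star> psi m \<star> psi n \<star> w"
    using w by (simp only: act_linear closed)
  moreover have "psi (- n) \<star> psi m \<star> psi n \<star> w = 0 - psi m \<star> psi (- n) \<star> psi n \<star> w"
    using psi_anticomm[of "psi n \<star> w" "- n" m] m w by auto
  ultimately show ?thesis by simp
qed

text \<open>Since \<open>psi k\<close> and \<open>psi (- k)\<close> square to 0, the anticommutation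
  relation makes \<open>psi (- k)\<close> after \<open>psi k\<close> idempotent, and an eigenvalue
  of an idempotent is 0 or 1.\<close>

lemma weight_space_value:
  assumes w: "w \<in> weight_space V l" "w \<noteq> 0" and k: "k \<ge> 1"
  shows "l k = 0 \<or> l k = 1"
proof -
  let ?k = "int k"
  have c: "w \<in> carr V" and e: "psi (- ?k) \<star> psi ?k \<star> w = l k \<cdot> w"
    using w by (auto simp: weight_space_def)
  have "psi (- ?k) \<star> psi ?k \<star> psi (- ?k) \<star> psi ?k \<star> w
      = psi (- ?k) \<star> (psi ?k \<star> w - psi (- ?k) \<star> psi ?k \<star> psi ?k \<star> w)"
    using psi_anticomm[of "psi ?k \<star> w" ?k "- ?k"] c by simp
  also have "\<dots> = l k \<cdot> w" using c k e by (simp add: psi_square act_linear)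
  finally have "(l k * l k) \<cdot> w = l k \<cdot> w" using c by (simp add: e act_linear)
  then show ?thesis using w(2) by auto
qed

text \<open>For eigenvalue 0, apply \<open>psi k\<close> to the eigenvalue equation:
  \<open>psi k\<close>, \<open>psi (- k)\<close>, \<open>psi k\<close> in succession act as
  \<open>psi k\<close> alone. For eigenvalue 1, \<open>w\<close> lies in the image of
  \<open>psi (- k)\<close>, whose square is 0.\<close>

lemma weight_space_kill:
  assumes w: "w \<in> weight_space V l" and k: "k \<ge> 1"
  shows "l k = 0 \<Longrightarrow> psi (int k) \<star> w = 0" and "l k = 1 \<Longrightarrow> psi (- int k) \<star> w = 0"
proof -
  let ?k = "int k"
  have c: "w \<in> carr V" and e: "psi (- ?k) \<star> psi ?k \<star> w = l k \<cdot> w"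
    using w by (auto simp: weight_space_def)
  show "psi ?k \<star> w = 0" if "l k = 0"
    using psi_anticomm[of "psi ?k \<star> w" ?k "- ?k"] that e c k by (simp add: psi_square act_linear)
  show "psi (- ?k) \<star> w = 0" if "l k = 1"
    using psi_square[of "psi ?k \<star> w" "- ?k"] that e c k by simp
qed

text \<open>The operators defining weights are even, so they respect both homogeneous components of
  \<open>w\<close>; at least one component is nonzero.\<close>

lemma weight_space_homogeneous:
  assumes w: "w \<in> weight_space V l" "w \<noteq> 0"
  obtains q u where "u \<in> part V q" "u \<in> weight_space V l" "u \<noteq> 0"
proof -
  have wc: "w \<in> carr V" using w by (simp add: weight_space_def)
  obtain a b where ab: "a \<in> part V 0" "b \<in> part V 1" "w = a + b"
    using is_direct_sum_bitE[OF fermion.smodule_ds[OF M] wc, of 0] by auto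
  have c: "a \<in> carr V" "b \<in> carr V" using ab fermion.part_subset_carr[OF M] by blast+
  have even: "psi m \<star> psi n \<star> u \<in> part V q" if "u \<in> part V q" for m n u q
    using fermion.smodule_act(1)[OF M psi_gr fermion.smodule_act(1)[OF M psi_gr that]]
    by (cases q) simp_all
  have "psi (- int k) \<star> psi (int k) \<star> a = l k \<cdot> a \<and> psi (- int k) \<star> psi (int k) \<star> b = l k \<cdot> b" for k
  proof -
    let ?d = "\<lambda>u. psi (- int k) \<star> psi (int k) \<star> u - l k \<cdot> u"
    have "?d (a + b) = 0" using w ab by (simp add: weight_space_def)
    then have s: "?d a + ?d b = 0"
      using c by (simp add: act_linear S.scale_right_distrib algebra_simps)
    have p: "?d a \<in> part V 0" "?d b \<in> part V 1" using ab even by simp_all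
    have "?d a = 0" "?d b = 0" using fermion.part_sum_zero[OF M p _ s] by simp_all
    then show ?thesis by simp
  qed
  then have "a \<in> weight_space V l" "b \<in> weight_space V l" using c by (simp_all add: weight_space_def)
  then show ?thesis using that ab w(2) by (metis add.right_neutral)
qed

end

section \<open>Anticommuting involutions\<close>

text \<open>The case \<open>k = 0\<close> is separate because \<open>psi 0 + psi 0\<close> would
  square to 2; the factor \<open>sqrt 2\<close> makes the square 1.\<close>

definition flipper :: "nat \<Rightarrow> fermion" where
  "flipper k = (if k = 0 then pm_scale (complex_of_real (sqrt 2)) (psi 0) else psi (int k) + psi (- int k))"

lemma flipper_gr: "flipper k \<in> fermion_gr 1"
  using fermion.subspace_add[OF fermion_gr_subspace psi_gr psi_gr]
    fermion.subspace_scale[OF fermion_gr_subspace psi_gr] by (simp add: flipper_def)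

lemma sqrt2_square: "complex_of_real (sqrt 2) * complex_of_real (sqrt 2) = 2"
  by (simp flip: of_real_mult)

text \<open>The 2 comes from the two mixed brackets of \<open>psi k\<close> and
  \<open>psi (- k)\<close> when \<open>k \<ge> 1\<close>, and from the square of
  \<open>sqrt 2\<close> when \<open>k = 0\<close>.\<close>

lemma flipper_br: "fermion_br (flipper k) (flipper l) = pm_scale (if k = l then 2 else 0) zel"
proof -
  have "zel + zel = pm_scale 2 zel"
    by (rule poly_mapping_eqI) (simp add: lookup_add)
  then show ?thesis
    by (cases "k = 0"; cases "l = 0"; cases "k = l")
      (simp_all add: flipper_def fermion_br_add_left fermion_br_scale_left fermion_br_add_right
        fermion_br_scale_right fermion_br_basis sqrt2_square)
qed

text \<open>The zero bracket is written as a multiple of \<open>zel\<close> to match the hypothesis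
  of \<open>odd_anticomm\<close>.\<close>

lemma psi_flipper_br: "nat \<bar>m\<bar> \<noteq> k \<Longrightarrow> fermion_br (psi m) (flipper k) = pm_scale 0 zel"
  by (auto simp: flipper_def fermion_br_add_right fermion_br_scale_right fermion_br_basis)

context unital_fermion_module
begin

lemma flipper_square:
  assumes "w \<in> carr V"
  shows "flipper k \<star> flipper k \<star> w = w"
proof -
  have "flipper k \<star> flipper k \<star> w + flipper k \<star> flipper k \<star> w = 2 \<cdot> w"
    using odd_anticomm[OF flipper_gr flipper_gr flipper_br assms, of k k] by (simp add: eq_diff_eq)
  then have "2 \<cdot> (flipper k \<star> flipper k \<star> w) = 2 \<cdot> w"
    using S.scale_left_distrib[of 1 1 "flipper k \<star> flipper k \<star> w"] by simp
  then show ?thesis by simp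
qed

lemma flipper_anticomm:
  assumes "w \<in> carr V" "k \<noteq> l"
  shows "flipper k \<star> flipper l \<star> w = - (flipper l \<star> flipper k \<star> w)"
  using odd_anticomm[OF flipper_gr flipper_gr flipper_br assms(1), of k l] assms(2) by simp

lemma psi_flipper:
  assumes "w \<in> carr V" "nat \<bar>m\<bar> \<noteq> k"
  shows "psi m \<star> flipper k \<star> w = - (flipper k \<star> psi m \<star> w)"
  using odd_anticomm[OF psi_gr flipper_gr psi_flipper_br[OF assms(2)] assms(1)] by simp

text \<open>The sign turns the anticommuting involutions \<open>flipper k\<close> into commuting involutions on
  the pairs \<open>(J, w)\<close>, so that \<open>\<xi>\<^sub>J\<close> can be reached from \<open>\<xi>\<^sub>I\<close> by an unordered
  fold.\<close>

definition flip_step :: "nat \<Rightarrow> nat set \<times> 'v \<Rightarrow> nat set \<times> 'v" where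
  "flip_step k = (\<lambda>(J, w). if w \<in> carr V then (xi_flip k J, xi_sign k J \<cdot> (flipper k \<star> w)) else (J, w))"

text \<open>Of two distinct indices, flipping the smaller changes the sign attached to the larger,
  but not conversely. This single sign cancels the one from \<open>flipper_anticomm\<close>.\<close>

lemma flip_step_commute: "flip_step k (flip_step l s) = flip_step l (flip_step k s)"
proof (cases "k = l")
  case False
  obtain J w where s: "s = (J, w)" by force
  show ?thesis
  \<comment> \<open>Outside the carrier every step is the identity, so the steps commute on the
    whole type, as \<open>comp_fun_commute\<close> demands.\<close>
  proof (cases "w \<in> carr V")
    case True
    have "(xi_sign k (xi_flip l J) * xi_sign l J) \<cdot> (flipper k \<star> flipper l \<star> w)
        = (xi_sign l (xi_flip k J) * xi_sign k J) \<cdot> (flipper l \<star> flipper k \<star> w)"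
      using flipper_anticomm[OF True False] False
      by (cases k l rule: linorder_cases) (simp_all add: xi_sign_flip mult.commute)
    then show ?thesis using True s
      by (simp add: flip_step_def act_linear xi_flip_flip(2)[of k l])
  qed (simp add: s flip_step_def)
qed simp

text \<open>The sign at \<open>k\<close> counts only elements below \<open>k\<close>, so it is the
  same before and after the flip and squares to 1.\<close>

lemma flip_step_flip_step: "flip_step k (flip_step k s) = s"
proof -
  obtain J w where s: "s = (J, w)" by force
  show ?thesis
    by (cases "w \<in> carr V") (simp_all add: s flip_step_def act_linear flipper_square xi_flip_flip(1)
        xi_sign_flip xi_sign_square)
qed

end

lemma xi_flip_class:
  assumes "J \<in> S_class I"
  shows "xi_flip k J \<in> S_class I" "xi_parity I (xi_flip k J) = xi_parity I J + 1"
  using S_class_update[OF assms, of k] xi_parity_insert[OF assms, of k] xi_parity_remove[OF assms, of k]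
  by (simp_all add: xi_flip_def)

lemma xi_sign_nz: "xi_sign k J \<noteq> 0"
  by (simp add: xi_sign_def)

section \<open>The vectors corresponding to the model basis\<close>

text \<open>\<open>v\<close> satisfies the annihilation conditions of \<open>\<xi>\<^sub>I\<close>.
  They leave open whether 0 is in \<open>I\<close>, because \<open>psi 0\<close> is injective on the
  carrier.\<close>

locale fermion_vacuum = unital_fermion_module V for V :: "(fermion, 'v::ab_group_add) smod" +
  fixes v :: 'v and p :: bit and I :: "nat set"
  assumes v_part: "v \<in> part V p" and v_nz: "v \<noteq> 0"
    and v_kill: "\<And>k. k \<ge> 1 \<Longrightarrow> act V (psi (if k \<in> I then - int k else int k)) v = 0"
begin

lemma v_carr [simp]: "v \<in> carr V"
  using v_part fermion.part_subset_carr[OF M] by blast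

text \<open>\<open>D\<close> is the set of places where the target set differs from
  \<open>I\<close>; the first component records the target set and the second the vector
  reached.\<close>

definition state :: "nat set \<Rightarrow> nat set \<times> 'v" where
  "state D = Finite_Set.fold flip_step (I, v) D"

text \<open>Adding \<open>k\<close> is the recursion of the fold; removing \<open>k\<close> reduces
  to it because \<open>flip_step k\<close> is an involution.\<close>

lemma state_flip:
  assumes "finite D"
  shows "flip_step k (state D) = state (xi_flip k D)"
proof -
  interpret comp_fun_commute flip_step
    by unfold_locales (simp add: fun_eq_iff flip_step_commute)
  have ins: "state (insert k E) = flip_step k (state E)" if "finite E" "k \<notin> E" for E
    unfolding state_def using that by (rule fold_insert)
  show ?thesis
  proof (cases "k \<in> D")
    case True
    then have "state D = flip_step k (state (D - {k}))"
      using ins[of "D - {k}"] assms by (simp add: insert_absorb)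
    then show ?thesis using True by (simp add: xi_flip_def flip_step_flip_step)
  next
    case False
    then show ?thesis using ins[of D] assms by (simp add: xi_flip_def)
  qed
qed

text \<open>The invariant of the fold: \<open>w\<close> has the parity, up to the shift by
  \<open>p\<close>, and the annihilators of \<open>\<xi>\<^sub>J\<close>.\<close>

definition good :: "nat set \<Rightarrow> 'v \<Rightarrow> bool" where
  "good J w \<longleftrightarrow> J \<in> S_class I \<and> w \<in> part V (p + xi_parity I J) \<and> w \<noteq> 0 \<and>
     w \<in> fermion.U_orbit V v \<and> (\<forall>k\<ge>1. psi (if k \<in> J then - int k else int k) \<star> w = 0)"

lemma good_carr: "good J w \<Longrightarrow> w \<in> carr V"
  unfolding good_def using fermion.part_subset_carr[OF M] by blast

lemma good_flip:
  assumes g: "good J w"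
  shows "good (xi_flip k J) (xi_sign k J \<cdot> (flipper k \<star> w))"
proof -
  have w: "w \<in> carr V" by (rule good_carr[OF g])
  have J: "J \<in> S_class I" using g by (simp add: good_def)
  have "flipper k \<star> w \<in> part V (1 + (p + xi_parity I J))"
    using fermion.smodule_act(1)[OF M flipper_gr] g unfolding good_def by blast
  then have part: "flipper k \<star> w \<in> part V (p + xi_parity I (xi_flip k J))"
    by (simp only: xi_flip_class[OF J] add_ac)
  have nz: "flipper k \<star> w \<noteq> 0"
    using flipper_square[OF w, of k] g by (auto simp: good_def act_linear)
  have orb: "xi_sign k J \<cdot> (flipper k \<star> w) \<in> fermion.U_orbit V v"
    using g S.subspace_scale[OF fermion.U_orbit_subspace[OF M v_carr]]
      fermion.U_orbit_act[OF M v_carr] unfolding good_def by blast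
  have kill: "psi (if n \<in> xi_flip k J then - int n else int n) \<star> flipper k \<star> w = 0" if n: "n \<ge> 1" for n
  proof (cases "n = k")
    case False
    have "psi (if n \<in> J then - int n else int n) \<star> w = 0" using g n by (simp add: good_def)
    then show ?thesis using False psi_flipper[OF w, of "if n \<in> J then - int n else int n" k]
      by (auto simp: xi_flip_mem act_linear)
  next
    case True
    have e: "psi (if n \<in> J then - int n else int n) \<star> w = 0" using g n by (simp add: good_def)
    \<comment> \<open>Only one summand of \<open>flipper n\<close> survives on \<open>w\<close>, and
      it is the very generator that must annihilate the result, so squares being 0 suffices.\<close>
    have "psi (int n) \<star> psi (int n) \<star> w = 0" "psi (- int n) \<star> psi (- int n) \<star> w = 0"
      using n w by (simp_all add: psi_square)
    then show ?thesis using e True n w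
      by (auto simp: xi_flip_mem flipper_def act_linear split: if_splits)
  qed
  show ?thesis
    unfolding good_def
    using xi_flip_class[OF J] part nz orb kill w by (simp add: xi_sign_nz act_linear)
qed

text \<open>The image intended for \<open>\<xi>\<^sub>J\<close>, reached by flipping the symmetric
  difference of \<open>I\<close> and \<open>J\<close>. For \<open>J\<close> outside
  \<open>S_class I\<close> that difference is infinite and the fold defaults to
  \<open>v\<close>.\<close>

definition xi :: "nat set \<Rightarrow> 'v" where
  "xi J = snd (state ((I - J) \<union> (J - I)))"

lemma state_good:
  assumes "finite D"
  shows "fst (state D) = {i. (i \<in> I) \<noteq> (i \<in> D)}" "good (fst (state D)) (snd (state D))"
proof -
  have "fst (state D) = {i. (i \<in> I) \<noteq> (i \<in> D)} \<and> good (fst (state D)) (snd (state D))"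
    using assms
  proof (induction D)
    case empty
    have "p + xi_parity I I = p" by (simp add: xi_parity_def)
    then have "good I v"
      unfolding good_def using v_part v_nz v_kill fermion.U_orbit_self[OF M v_carr]
      by (simp only:) (simp add: S_class_def)
    then show ?case by (simp add: state_def)
  next
    case (insert k D)
    obtain J w where s: "state D = (J, w)" by force
    have "state (insert k D) = flip_step k (J, w)"
      using state_flip[OF insert(1), of k] insert(2) s by (simp add: xi_flip_def)
    moreover have g: "good J w" and J: "J = {i. (i \<in> I) \<noteq> (i \<in> D)}" 
      using insert.IH unfolding s fst_conv snd_conv by blast+
    ultimately have "state (insert k D) = (xi_flip k J, xi_sign k J \<cdot> (flipper k \<star> w))"
      using good_carr[OF g] by (simp add: flip_step_def)
    moreover have "xi_flip k J = {i. (i \<in> I) \<noteq> (i \<in> insert k D)}"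
      using insert(2) unfolding J by (auto simp: set_eq_iff xi_flip_mem split: if_splits)
    ultimately show ?case using good_flip[OF g, of k] by (metis fst_conv snd_conv)
  qed
  then show "fst (state D) = {i. (i \<in> I) \<noteq> (i \<in> D)}" "good (fst (state D)) (snd (state D))" by auto
qed

lemma state_xi:
  assumes "J \<in> S_class I"
  shows "state ((I - J) \<union> (J - I)) = (J, xi J)"
proof -
  have "finite ((I - J) \<union> (J - I))" using assms by (simp add: S_class_def)
  from state_good(1)[OF this] have "fst (state ((I - J) \<union> (J - I))) = J" by auto
  then show ?thesis by (simp add: xi_def prod_eq_iff)
qed

lemma xi_good:
  assumes "J \<in> S_class I"
  shows "good J (xi J)"
  using state_good(2)[of "(I - J) \<union> (J - I)"] assms state_xi[OF assms] by (simp add: S_class_def)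

lemma xi_carr: "J \<in> S_class I \<Longrightarrow> xi J \<in> carr V"
  using xi_good good_carr by blast

lemma xi_self: "xi I = v"
  by (simp add: xi_def state_def)

text \<open>Flipping \<open>k\<close> in \<open>J\<close> flips \<open>k\<close> in the symmetric
  difference with \<open>I\<close>, so \<open>state_flip\<close> applies; the sign changes sides
  because it squares to 1.\<close>

lemma flipper_xi:
  assumes J: "J \<in> S_class I"
  shows "flipper k \<star> xi J = xi_sign k J \<cdot> xi (xi_flip k J)"
proof -
  let ?D = "(I - J) \<union> (J - I)" and ?J = "xi_flip k J"
  have "xi_flip k ?D = (I - ?J) \<union> (?J - I)" by (auto simp: xi_flip_mem set_eq_iff)
  moreover have "finite ?D" using J by (simp add: S_class_def)
  ultimately have "flip_step k (J, xi J) = (?J, xi ?J)"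
    using state_flip[of ?D k] state_xi[OF J] state_xi[OF xi_flip_class(1)[OF J]] by metis
  then have "xi ?J = xi_sign k J \<cdot> (flipper k \<star> xi J)"
    using xi_carr[OF J] by (simp add: flip_step_def)
  then show ?thesis by (simp add: xi_sign_square)
qed

text \<open>For nonzero \<open>m\<close> one of the two summands of the involution at
  \<open>nat \<bar>m\<bar>\<close> annihilates \<open>xi J\<close>, so the other one carries the
  full value given by \<open>flipper_xi\<close>.\<close>

lemma psi_xi:
  assumes J: "J \<in> S_class I"
  shows "psi m \<star> xi J = xi_coeff m J \<cdot> xi (xi_flip (nat \<bar>m\<bar>) J)"
proof (cases "m = 0")
  case True
  \<comment> \<open>No index lies below 0, so \<open>xi_sign 0 J\<close> is 1.\<close>
  have "complex_of_real (sqrt 2) \<cdot> (psi 0 \<star> xi J) = xi (xi_flip 0 J)"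
    using flipper_xi[OF J, of 0] xi_carr[OF J] by (simp add: flipper_def act_linear xi_sign_def)
  then have "(1 / complex_of_real (sqrt 2)) \<cdot> complex_of_real (sqrt 2) \<cdot> (psi 0 \<star> xi J)
      = (1 / complex_of_real (sqrt 2)) \<cdot> xi (xi_flip 0 J)" by simp
  then show ?thesis using True by (simp add: xi_coeff_def)
next
  case False
  define k where "k = nat \<bar>m\<bar>"
  have k: "k \<ge> 1" "m = int k \<or> m = - int k" using False by (auto simp: k_def)
  have kill: "psi (if k \<in> J then - int k else int k) \<star> xi J = 0"
    using xi_good[OF J] k unfolding good_def by blast
  have flip: "psi (int k) \<star> xi J + psi (- int k) \<star> xi J = xi_sign k J \<cdot> xi (xi_flip k J)"
    using flipper_xi[OF J, of k] xi_carr[OF J] k by (simp add: flipper_def act_linear)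
  show ?thesis using kill flip k False
    by (cases "k \<in> J") (auto simp: xi_coeff_def simp flip: k_def)
qed

section \<open>The embedding of the model module\<close>

definition embed :: "(nat set \<Rightarrow>\<^sub>0 complex) \<Rightarrow> 'v" where
  "embed = lin_ext (smul V) xi"

lemma embed_linear:
  "embed 0 = 0" "embed (f + g) = embed f + embed g" "embed (pm_scale c f) = c \<cdot> embed f"
  "embed (bvec J) = xi J" "embed (Poly_Mapping.single J c) = c \<cdot> xi J"
  using S.vector_space_axioms
  by (simp_all add: embed_def lin_ext_add lin_ext_scale lin_ext_single lin_ext_def[of _ _ 0])

lemma V_mod_simps:
  "f \<in> carr (V_mod I) \<longleftrightarrow> Poly_Mapping.keys f \<subseteq> S_class I" "smul (V_mod I) = pm_scale"
  "f \<in> part (V_mod I) q \<longleftrightarrow> Poly_Mapping.keys f \<subseteq> {J \<in> S_class I. xi_parity I J = q}"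
  by (simp_all add: V_mod_def)

lemma embed_part: "f \<in> part (V_mod I) q \<Longrightarrow> embed f \<in> part V (q + p)"
  unfolding V_mod_simps
proof (induction f rule: pm_induct)
  case (basis J)
  then show ?case using xi_good[of J] by (auto simp: good_def embed_linear add.commute)
qed (simp_all add: embed_linear)

lemma embed_orbit: "f \<in> carr (V_mod I) \<Longrightarrow> embed f \<in> fermion.U_orbit V v"
  unfolding V_mod_simps
proof (induction f rule: pm_induct)
  case (basis J)
  then show ?case using xi_good[of J] by (simp add: good_def embed_linear)
qed (simp_all add: embed_linear S.subspace_0 S.subspace_add S.subspace_scale
    fermion.U_orbit_subspace[OF M v_carr])

lemma embed_carr: "f \<in> carr (V_mod I) \<Longrightarrow> embed f \<in> carr V"
  unfolding V_mod_simps
  by (induction f rule: pm_induct) (simp_all add: embed_linear xi_carr)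

text \<open>Linearity in both arguments reduces the claim to generators and basis vectors, where it
  is \<open>psi_xi\<close> or the identity action of \<open>zel\<close>.\<close>

lemma embed_act:
  assumes f: "f \<in> carr (V_mod I)"
  shows "embed (act (V_mod I) x f) = x \<star> embed f"
proof -
  note N = V_mod_smodule[of I]
  have "Poly_Mapping.keys x \<subseteq> UNIV" by simp
  then show ?thesis
  proof (induction x rule: pm_induct)
    case (basis a)
    have "Poly_Mapping.keys f \<subseteq> S_class I" using f by (simp add: V_mod_simps)
    \<comment> \<open>Membership is carried through the induction because linearity of the action is
      available only on the carrier.\<close>
    then have "f \<in> carr (V_mod I) \<and> embed (act (V_mod I) (bvec a) f) = bvec a \<star> embed f"
    proof (induction f rule: pm_induct)
      case zero
      show ?case using fermion.smodule_closed(1)[OF N] fermion.smodule_act_zero(1)[OF N]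
        by (simp add: embed_linear act_linear)
    next
      case (add g h)
      then show ?case using fermion.smodule_closed(2)[OF N, of g h] fermion.smodule_act(5)[OF N, of g h]
        by (simp add: embed_linear act_linear embed_carr)
    next
      case (scale c g)
      then show ?case using fermion.smodule_closed(4)[OF N, of g c] fermion.smodule_act(6)[OF N, of g _ c]
        by (simp add: embed_linear act_linear embed_carr V_mod_simps(2))
    next
      case (basis J)
      have "act (V_mod I) (bvec a) (bvec J) = xi_act a J"
        by (simp add: V_mod_def lin_ext_single[OF vector_space_pm_scale]
            vector_space.vector_space_assms(4)[OF vector_space_pm_scale])
      moreover have "embed (xi_act a J) = bvec a \<star> xi J"
      proof (cases a)
        case (Psi m)
        show ?thesis unfolding Psi xi_act_Psi psi_xi[OF basis] by (simp add: embed_linear)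
      next
        case Zc
        then show ?thesis by (simp add: embed_linear unital xi_carr basis)
      qed
      ultimately show ?case using basis by (simp add: embed_linear V_mod_simps)
    qed
    then show ?case by blast
  next
    case zero
    show ?case using fermion.smodule_act_zero(2)[OF N f] embed_carr[OF f] by (simp add: embed_linear act_linear)
  next
    case (add x y)
    then show ?case using fermion.smodule_act(3)[OF N f] embed_carr[OF f] by (simp add: embed_linear act_linear)
  next
    case (scale c x)
    then show ?case using fermion.smodule_act(4)[OF N f] embed_carr[OF f]
      by (simp add: embed_linear act_linear V_mod_simps(2))
  qed
qed

lemma number_op_embed:
  assumes f: "f \<in> carr (V_mod I)" and k: "k \<ge> 1"
  shows "psi (- int k) \<star> psi (int k) \<star> embed f = embed (restrict_pm {J. k \<in> J} f)"
proof -
  have "Poly_Mapping.keys f \<subseteq> S_class I" using f by (simp add: V_mod_simps)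
  then have "f \<in> carr (V_mod I) \<and>
      psi (- int k) \<star> psi (int k) \<star> embed f = embed (restrict_pm {J. k \<in> J} f)"
  proof (induction f rule: pm_induct)
    case zero
    then show ?case by (simp add: V_mod_simps restrict_pm_linear embed_linear act_linear)
  next
    case (add g h)
    then show ?case using fermion.smodule_closed(2)[OF V_mod_smodule, of g I h]
      by (simp add: restrict_pm_linear embed_linear act_linear embed_carr)
  next
    case (scale c g)
    then show ?case using fermion.smodule_closed(4)[OF V_mod_smodule, of g I c]
      by (simp add: restrict_pm_linear embed_linear act_linear embed_carr V_mod_simps(2))
  next
    case (basis J)
    have "psi (- int k) \<star> psi (int k) \<star> xi J
        = (xi_coeff (int k) J * xi_coeff (- int k) (xi_flip k J)) \<cdot> xi (xi_flip k (xi_flip k J))"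
      using basis xi_flip_class[OF basis] by (simp add: psi_xi act_linear xi_carr)
    \<comment> \<open>If \<open>k \<in> J\<close>, both coefficients are the sign at
      \<open>k\<close>, whose square is 1; otherwise the first one is 0.\<close>
    also have "\<dots> = (if k \<in> J then 1 else 0) \<cdot> xi J"
      using k by (simp add: xi_coeff_def xi_flip_flip(1) xi_flip_mem xi_sign_flip xi_sign_square)
    finally show ?case using basis by (simp add: V_mod_simps restrict_pm_linear embed_linear)
  qed
  then show ?thesis by blast
qed

text \<open>Restricting to the \<open>J\<close> with \<open>k \<in> J\<close> is the operator \<open>\<psi>\<^bsub>-k\<^esub>\<psi>\<^bsub>k\<^esub>\<close>; two sets
  that differ only in \<open>0\<close> have the same weight and are told apart by parity.\<close>

lemma embed_kernel:
  assumes f: "f \<in> carr (V_mod I)" and 0: "embed f = 0"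
  shows "f = 0"
proof (rule trivial_if_separating_restrictions[where K = "{f \<in> carr (V_mod I). embed f = 0}"])
  show "c = 0" if "Poly_Mapping.single J c \<in> {f \<in> carr (V_mod I). embed f = 0}" for J c
    using that xi_good[of J] by (auto simp: V_mod_simps embed_linear good_def split: if_splits)
  show "f \<in> {f \<in> carr (V_mod I). embed f = 0}" using f 0 by simp
next
  fix f J K
  assume f: "f \<in> {f \<in> carr (V_mod I). embed f = 0}"
    and J: "J \<in> Poly_Mapping.keys f" "K \<in> Poly_Mapping.keys f" "J \<noteq> K"
  have restr: "restrict_pm A f \<in> carr (V_mod I)" for A
    using f by (auto simp: V_mod_simps keys_restrict_pm)
  show "\<exists>A. (J \<in> A) \<noteq> (K \<in> A) \<and> restrict_pm A f \<in> {f \<in> carr (V_mod I). embed f = 0}"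
  proof (cases "\<exists>k\<ge>1. (k \<in> J) \<noteq> (k \<in> K)")
    case True
    then obtain k where k: "k \<ge> 1" "(k \<in> J) \<noteq> (k \<in> K)" by blast
    then have "embed (restrict_pm {J. k \<in> J} f) = 0"
      using number_op_embed[of f k] f by (simp add: act_linear)
    then show ?thesis using k restr by (intro exI[of _ "{J. k \<in> J}"]) simp
  next
    case False
    have S: "J \<in> S_class I" "K \<in> S_class I" using f J by (auto simp: V_mod_simps)
    have pos: "k \<in> J \<longleftrightarrow> k \<in> K" if "k \<noteq> 0" for k using False that by simp
    have "(0 \<in> J) \<noteq> (0 \<in> K)"
      using pos J(3) by (metis set_eqI)
    then have "J = xi_flip 0 K" using pos
      by (intro set_eqI) (metis xi_flip_mem)
    then have par: "xi_parity I J = xi_parity I K + 1" using xi_flip_class(2)[OF S(2)] by simp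
    let ?A = "{L. xi_parity I L = xi_parity I J}"
    have neq: "xi_parity I L = xi_parity I K" if "xi_parity I L \<noteq> xi_parity I J" for L
      using that par by (cases "xi_parity I L"; cases "xi_parity I K") simp_all
    have "Poly_Mapping.keys (restrict_pm ?A f) \<subseteq> {L \<in> S_class I. xi_parity I L = xi_parity I J}"
      "Poly_Mapping.keys (restrict_pm (- ?A) f) \<subseteq> {L \<in> S_class I. xi_parity I L = xi_parity I K}"
      using f neq by (auto simp: V_mod_simps keys_restrict_pm)
    then have "restrict_pm ?A f \<in> part (V_mod I) (xi_parity I J)"
      "restrict_pm (- ?A) f \<in> part (V_mod I) (xi_parity I K)" by (simp_all only: V_mod_simps)
    note parts = this[THEN embed_part]
    \<comment> \<open>The two restrictions are the homogeneous components of \<open>f\<close>. Their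
      images lie in different parts and add up to 0, so each vanishes.\<close>
    have s: "embed (restrict_pm ?A f) + embed (restrict_pm (- ?A) f) = 0"
      using f unfolding embed_linear(2)[symmetric] restrict_pm_split[of f ?A, symmetric] by simp
    have "xi_parity I J + p \<noteq> xi_parity I K + p"
      using par by (cases "xi_parity I K") (simp_all only: add_right_cancel, simp_all)
    then have "embed (restrict_pm ?A f) = 0"
      using fermion.part_sum_zero(1)[OF M parts _ s] by blast
    then show ?thesis using restr par by (intro exI[of _ ?A]) simp
  qed
qed

text \<open>The image is a submodule containing \<open>v = xi I\<close>, hence contains the orbit;
  conversely every \<open>xi J\<close> was reached from \<open>v\<close> inside the orbit.\<close>

lemma embed_image: "embed ` carr (V_mod I) = fermion.U_orbit V v"
proof
  show "embed ` carr (V_mod I) \<subseteq> fermion.U_orbit V v" using embed_orbit by blast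
  show "fermion.U_orbit V v \<subseteq> embed ` carr (V_mod I)"
  proof (rule fermion.U_orbit_minimal[OF M v_carr])
    note N = V_mod_smodule[of I]
    show "S.subspace (embed ` carr (V_mod I))"
    proof (rule S.subspaceI)
      show "0 \<in> embed ` carr (V_mod I)"
        using fermion.smodule_closed(1)[OF N] embed_linear(1) by (metis imageI)
      show "x + y \<in> embed ` carr (V_mod I)"
        if "x \<in> embed ` carr (V_mod I)" "y \<in> embed ` carr (V_mod I)" for x y
        using that fermion.smodule_closed(2)[OF N] by (auto simp flip: embed_linear)
      show "c \<cdot> x \<in> embed ` carr (V_mod I)" if "x \<in> embed ` carr (V_mod I)" for c x
        using that fermion.smodule_closed(4)[OF N] by (auto simp: V_mod_simps(2) simp flip: embed_linear)
    qed
    have "bvec I \<in> carr (V_mod I)" by (simp add: V_mod_simps S_class_def)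
    then show "v \<in> embed ` carr (V_mod I)" using embed_linear(4)[of I] xi_self by (metis imageI)
    show "x \<star> w \<in> embed ` carr (V_mod I)" if "w \<in> embed ` carr (V_mod I)" for x w
      using that fermion.smodule_act(2)[OF N] by (auto simp flip: embed_act)
  qed
qed

text \<open>The isomorphism has the parity of \<open>v\<close>, because \<open>bvec I\<close> is
  even.\<close>

lemma U_orbit_iso:
  "\<exists>\<phi>. fermion.smod_iso p (sub_smod V (fermion.U_orbit V v)) (V_mod I) \<phi> \<and> \<phi> v = bvec I"
proof -
  note N = V_mod_smodule[of I]
  have inj: "inj_on embed (carr (V_mod I))"
  proof (rule inj_onI)
    fix f g assume fg: "f \<in> carr (V_mod I)" "g \<in> carr (V_mod I)" "embed f = embed g"
    have "embed (f - g) + embed g = embed f" using embed_linear(2)[of "f - g" g] by simp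
    then have "embed (f - g) = 0" using fg by simp
    then have "f - g = 0" using embed_kernel fermion.smodule_closed(3)[OF N fg(1,2)] by blast
    then show "f = g" by simp
  qed
  have "bvec I \<in> carr (V_mod I)" by (simp add: V_mod_simps S_class_def)
  then have "inv_into (carr (V_mod I)) embed v = bvec I"
    using inv_into_f_f[OF inj] embed_linear(4)[of I] xi_self by metis
  moreover have "fermion.smod_iso p (sub_smod V (embed ` carr (V_mod I))) (V_mod I)
      (inv_into (carr (V_mod I)) embed)"
    by (rule fermion.iso_inverse_of_embedding[OF M N inj])
      (fact embed_part | simp add: embed_carr embed_linear embed_act V_mod_simps(2))+
  ultimately show ?thesis unfolding embed_image by blast
qed

end

section \<open>Orbits of weight vectors and simple modules\<close>

context unital_fermion_module
begin

lemma weight_vector_orbit_iso: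
  assumes v: "v \<in> weight_space V l" "v \<in> part V p" "v \<noteq> 0"
  shows "\<exists>I \<phi>. fermion.smod_iso p (sub_smod V (fermion.U_orbit V v)) (V_mod I) \<phi> \<and> \<phi> v = bvec I"
proof -
  \<comment> \<open>Leaving 0 out of \<open>I\<close> is a choice: the eigenvalue at 0 is 1/2 and
    does not distinguish the two cases.\<close>
  interpret fermion_vacuum V v p "{k. k \<ge> 1 \<and> l k = 1}"
  proof
    fix k :: nat assume k: "k \<ge> 1"
    show "psi (if k \<in> {k. k \<ge> 1 \<and> l k = 1} then - int k else int k) \<star> v = 0"
      using weight_space_value[OF v(1,3) k] weight_space_kill[OF v(1) k] k by auto
  qed (use v in auto)
  show ?thesis using U_orbit_iso by blast
qed

text \<open>An odd weight vector is replaced by its image under \<open>psi 0\<close>. That image is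
  nonzero since \<open>psi 0\<close> squares to 1/2, and evenness of the vector later makes the
  isomorphism even.\<close>

lemma even_weight_vector:
  assumes "w \<in> weight_space V l" "w \<noteq> 0"
  obtains u where "u \<in> part V 0" "u \<in> weight_space V l" "u \<noteq> 0"
proof -
  obtain q u where u: "u \<in> part V q" "u \<in> weight_space V l" "u \<noteq> 0"
    using weight_space_homogeneous[OF assms] by blast
  show ?thesis
  proof (cases "q = 0")
    case True
    then show ?thesis using that u by blast
  next
    case False
    have c: "u \<in> carr V" and wt: "psi (- int k) \<star> psi (int k) \<star> u = l k \<cdot> u" for k
      using u by (simp_all add: weight_space_def)
    have p0: "psi 0 \<star> u \<in> part V 0"
      using fermion.smodule_act(1)[OF M psi_gr u(1)] False by simp
    have nz: "psi 0 \<star> u \<noteq> 0" using psi0_square[OF c] u(3) by (auto simp: act_linear)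
    have "psi (- int k) \<star> psi (int k) \<star> psi 0 \<star> u = l k \<cdot> (psi 0 \<star> u)" for k
    proof (cases "k = 0")
      case True
      then show ?thesis using wt[of 0] c by (simp add: act_linear)
    next
      case False
      then show ?thesis using psi_commutes_even[OF c, of 0 "int k"] wt[of k] c by (simp add: act_linear)
    qed
    then have "psi 0 \<star> u \<in> weight_space V l" using c by (simp add: weight_space_def)
    then show ?thesis using that p0 nz by blast
  qed
qed

lemma simple_weight_module_iso:
  assumes simple: "fermion.simple_smodule V" and w: "w \<in> weight_space V l" "w \<noteq> 0"
  shows "\<exists>I. fermion.smod_isomorphic V (V_mod I)"
proof -
  obtain u where u: "u \<in> part V 0" "u \<in> weight_space V l" "u \<noteq> 0"
    using even_weight_vector[OF w] by blast
  let ?U = "fermion.U_orbit V u"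
  obtain I \<phi> where iso: "fermion.smod_iso 0 (sub_smod V ?U) (V_mod I) \<phi>"
    using weight_vector_orbit_iso[OF u(2,1,3)] by blast
  have c: "u \<in> carr V" using u by (simp add: weight_space_def)
  have "?U \<subseteq> carr V"
    using fermion.U_orbit_eq[OF M c] fermion.free_act_carr[OF M c] by auto
  \<comment> \<open>That the orbit is a module is part of the isomorphism just obtained.\<close>
  then have "fermion.graded_submodule V ?U"
    using iso by (simp add: fermion.graded_submodule_def fermion.smod_iso_def)
  moreover have "?U \<noteq> {0}" using fermion.U_orbit_self[OF M c] u(3) by blast
  ultimately have U: "?U = carr V" using simple by (auto simp: fermion.simple_smodule_def)
  have "part (sub_smod V ?U) = part V"
    unfolding U sub_smod_def using fermion.part_subset_carr[OF M] by (auto simp: fun_eq_iff)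
  then have "sub_smod V ?U = V" unfolding U by (simp add: sub_smod_def)
  then show ?thesis using iso by (auto simp: fermion.smod_isomorphic_def)
qed

end

theorem lemma3p11:
  fixes V :: "(fermion, 'v::ab_group_add) smod"
  assumes "weight_module V"
    and "\<forall>v\<in>carr V. act V zel v = v"
  shows "(\<forall>l. weight_space V l \<noteq> {0} \<longrightarrow> (\<forall>k\<ge>1. l k = 0 \<or> l k = 1)) \<and>
    (\<forall>l p v. v \<in> weight_space V l \<and> v \<in> part V p \<and> v \<noteq> 0 \<longrightarrow>
       (\<exists>I \<phi>. fermion.smod_iso p (sub_smod V (fermion.U_orbit V v)) (V_mod I) \<phi> \<and>
          \<phi> v = bvec I)) \<and>
    (fermion.simple_smodule V \<longrightarrow> (\<exists>I. fermion.smod_isomorphic V (V_mod I)))"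
proof -
  interpret unital_fermion_module V
    using assms by unfold_locales (auto simp: weight_module_def)
  have ds: "is_direct_sum (smul V) (carr V) (weight_space V)"
    using assms by (simp add: weight_module_def)
  show ?thesis
  proof (intro conjI allI impI)
    fix l :: "nat \<Rightarrow> complex" and k :: nat
    assume l: "weight_space V l \<noteq> {0}" and k: "k \<ge> 1"
    have "0 \<in> weight_space V l" by (simp add: weight_space_def act_linear)
    then obtain w where "w \<in> weight_space V l" "w \<noteq> 0" using l by blast
    then show "l k = 0 \<or> l k = 1" using weight_space_value k by blast
  next
    fix l p v
    assume "v \<in> weight_space V l \<and> v \<in> part V p \<and> v \<noteq> 0"
    then show "\<exists>I \<phi>. fermion.smod_iso p (sub_smod V (fermion.U_orbit V v)) (V_mod I) \<phi> \<and> \<phi> v = bvec I"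
      using weight_vector_orbit_iso by blast
  next
    assume simple: "fermion.simple_smodule V"
    have "carr V \<noteq> {0}" using simple by (simp add: fermion.simple_smodule_def)
    then obtain x where x: "x \<in> carr V" "x \<noteq> 0" using closed(1) by blast
    \<comment> \<open>A nonzero vector has a nonzero component in the weight decomposition, which
      provides the weight vector to start from.\<close>
    obtain f :: "(nat \<Rightarrow> complex) \<Rightarrow>\<^sub>0 'v" where f: "\<And>l. Poly_Mapping.lookup f l \<in> weight_space V l"
      "x = (\<Sum>l\<in>Poly_Mapping.keys f. Poly_Mapping.lookup f l)"
      using ds x(1) unfolding is_direct_sum_def by blast
    then obtain l where "Poly_Mapping.lookup f l \<noteq> 0"
      using x(2) by (metis sum.neutral)
    then show "\<exists>I. fermion.smod_isomorphic V (V_mod I)"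
      using simple_weight_module_iso[OF simple f(1)] by blast
  qed
qed

end
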